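(* For the channel $Y(k)=X_1(k)+X_2(k)+S(k)+Z(k)$ with $\{Z(k)\}$ i.i.d. $\mathcal{N}(0,\sigma_Z^2)$, $\{S(k)\}$ i.i.d. with zero mean and finite variance $\sigma_S^2<\infty$ (not necessarily Gaussian) known non-causally to both transmitters, perfect causal output feedback to both transmitters, and average power constraints $P_1,P_2$: for every $\rho\in[0,1]$ and every pair $(R_1,R_2)$ with $$R_1=\tfrac12\log\Bigl(1+\tfrac{P_1(1-\rho^2)}{\sigma_Z^2}\Bigr),\quad R_2=\tfrac12\log\Bigl(1+\tfrac{P_2(1-\rho^2)}{\sigma_Z^2}\Bigr),\quad R_1+R_2=\tfrac12\log\Bigl(1+\tfrac{P_1+P_2+2\rho\sqrt{P_1P_2}}{\sigma_Z^2}\Bigr),$$ the rate pair $(R_1,R_2)$ is achievable; in particular the sum capacity of this channel equals the sum capacity of the Gaussian MAC with feedback without interference.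
   Context: Codes: $X_i(k)=f_{i,k}(w_i,S^n,Y^{k-1})$ with $w_i\in\{1,\dots,2^{nR_i}\}$, messages independent and uniform, average power constraint $\frac1n\sum_k\mathbb{E}[X_i(k)^2]\le P_i$ (asymptotically as $n\to\infty$), decoder $g(Y^n)$; achievable means average error probability tends to $0$ as $n\to\infty$. Logarithms base 2. *)

theory Defs
  imports "HOL-Probability.Probability"
begin

text \<open>Encoder type: time index k, message w, full state sequence s (non-causal),
  past outputs (Y(j) for j < k, zero elsewhere) gives the channel input X(k).
  Indices are 0-based: time k ranges over 0..n-1.\<close>
type_synonym encoder = "nat \<Rightarrow> nat \<Rightarrow> (nat \<Rightarrow> real) \<Rightarrow> (nat \<Rightarrow> real) \<Rightarrow> real"

fun mac_outs :: "encoder \<Rightarrow> encoder \<Rightarrow> nat \<Rightarrow> nat \<Rightarrow> (nat \<Rightarrow> real) \<Rightarrow> (nat \<Rightarrow> real)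
    \<Rightarrow> nat \<Rightarrow> real list" where
  "mac_outs f1 f2 w1 w2 s z 0 = []"
| "mac_outs f1 f2 w1 w2 s z (Suc k) =
     (let ys = mac_outs f1 f2 w1 w2 s z k;
          past = (\<lambda>j. if j < k then ys ! j else 0)
      in ys @ [f1 k w1 s past + f2 k w2 s past + s k + z k])"

definition past_out :: "encoder \<Rightarrow> encoder \<Rightarrow> nat \<Rightarrow> nat \<Rightarrow> (nat \<Rightarrow> real) \<Rightarrow> (nat \<Rightarrow> real)
    \<Rightarrow> nat \<Rightarrow> nat \<Rightarrow> real" where
  "past_out f1 f2 w1 w2 s z k = (\<lambda>j. if j < k then mac_outs f1 f2 w1 w2 s z k ! j else 0)"

definition mac_input :: "encoder \<Rightarrow> encoder \<Rightarrow> encoder \<Rightarrow> nat \<Rightarrow> nat \<Rightarrow> nat \<Rightarrow> (nat \<Rightarrow> real)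
    \<Rightarrow> (nat \<Rightarrow> real) \<Rightarrow> nat \<Rightarrow> real" where
  "mac_input f f1 f2 w w1 w2 s z k = f k w s (past_out f1 f2 w1 w2 s z k)"

definition sample_space :: "real measure \<Rightarrow> real \<Rightarrow> nat \<Rightarrow> ((nat \<Rightarrow> real) \<times> (nat \<Rightarrow> real)) measure" where
  "sample_space DS sigmaZ n =
     (PiM {..<n} (\<lambda>_. DS)) \<Otimes>\<^sub>M (PiM {..<n} (\<lambda>_. density lborel (normal_density 0 sigmaZ)))"

definition num_msgs :: "real \<Rightarrow> nat \<Rightarrow> nat" where
  "num_msgs R n = nat \<lceil>2 powr (real n * R)\<rceil>"

definition error_prob :: "real measure \<Rightarrow> real \<Rightarrow> nat \<Rightarrow> nat \<Rightarrow> nat \<Rightarrow> encoder \<Rightarrow> encoder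
    \<Rightarrow> ((nat \<Rightarrow> real) \<Rightarrow> nat \<times> nat) \<Rightarrow> real" where
  "error_prob DS sigmaZ n M1 M2 f1 f2 g =
     (1 / (real M1 * real M2)) *
     (\<Sum>w1\<in>{1..M1}. \<Sum>w2\<in>{1..M2}.
        measure (sample_space DS sigmaZ n)
          {\<omega> \<in> space (sample_space DS sigmaZ n).
             g (past_out f1 f2 w1 w2 (fst \<omega>) (snd \<omega>) n) \<noteq> (w1, w2)})"

definition total_energy :: "real measure \<Rightarrow> real \<Rightarrow> nat \<Rightarrow> nat \<Rightarrow> nat \<Rightarrow> encoder
    \<Rightarrow> encoder \<Rightarrow> encoder \<Rightarrow> bool \<Rightarrow> ennreal" where
  "total_energy DS sigmaZ n M1 M2 f1 f2 f first =
     (\<Sum>k<n. \<Sum>w1\<in>{1..M1}. \<Sum>w2\<in>{1..M2}.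
        \<integral>\<^sup>+ \<omega>. ennreal ((mac_input f f1 f2 (if first then w1 else w2) w1 w2
                                 (fst \<omega>) (snd \<omega>) k)\<^sup>2) \<partial>sample_space DS sigmaZ n)"

definition measurable_code :: "encoder \<Rightarrow> encoder \<Rightarrow> ((nat \<Rightarrow> real) \<Rightarrow> nat \<times> nat) \<Rightarrow> bool" where
  "measurable_code f1 f2 g \<longleftrightarrow>
     (\<forall>k w. (\<lambda>(s, y). f1 k w s y) \<in> borel_measurable
               (PiM UNIV (\<lambda>_::nat. borel :: real measure) \<Otimes>\<^sub>M PiM UNIV (\<lambda>_::nat. borel :: real measure))) \<and>
     (\<forall>k w. (\<lambda>(s, y). f2 k w s y) \<in> borel_measurable
               (PiM UNIV (\<lambda>_::nat. borel :: real measure) \<Otimes>\<^sub>M PiM UNIV (\<lambda>_::nat. borel :: real measure))) \<and>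
     g \<in> measurable (PiM UNIV (\<lambda>_::nat. borel :: real measure)) (count_space UNIV)"

definition achievable :: "real measure \<Rightarrow> real \<Rightarrow> real \<Rightarrow> real \<Rightarrow> real \<Rightarrow> real \<Rightarrow> bool" where
  "achievable DS sigmaZ P1 P2 R1 R2 \<longleftrightarrow>
     (\<exists>(f1 :: nat \<Rightarrow> encoder) (f2 :: nat \<Rightarrow> encoder) (g :: nat \<Rightarrow> (nat \<Rightarrow> real) \<Rightarrow> nat \<times> nat).
        (\<forall>n. measurable_code (f1 n) (f2 n) (g n)) \<and>
        (\<forall>\<epsilon>>0. eventually (\<lambda>n.
            total_energy DS sigmaZ n (num_msgs R1 n) (num_msgs R2 n) (f1 n) (f2 n) (f1 n) True
              \<le> ennreal (real n * real (num_msgs R1 n) * real (num_msgs R2 n) * (P1 + \<epsilon>)) \<and>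
            total_energy DS sigmaZ n (num_msgs R1 n) (num_msgs R2 n) (f1 n) (f2 n) (f2 n) False
              \<le> ennreal (real n * real (num_msgs R1 n) * real (num_msgs R2 n) * (P2 + \<epsilon>)))
          sequentially) \<and>
        (\<lambda>n. error_prob DS sigmaZ n (num_msgs R1 n) (num_msgs R2 n) (f1 n) (f2 n) (g n))
          \<longlonglongrightarrow> 0)"

end

theory Submission
  imports Defs "HOL-Real_Asymp.Real_Asymp"
begin

text \<open>
  Ozarow's linear feedback scheme for the Gaussian multiple-access channel, preceded by an
  exact cancellation of the state. Message \<open>w\<close> out of \<open>M\<close> is mapped to \<open>\<theta> = w / M\<close> and sent
  with amplitude \<open>a\<close>; from then on both encoders, which see the outputs, send scaled copies of
  the receiver's current normalised estimation errors. The receiver's estimates are fixed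
  linear statistics of the outputs and the state enters the outputs additively, so encoders
  that know the whole state sequence in advance can add to their first inputs exactly what
  removes the state from these statistics.

  The normalised errors are Gaussian linear forms in the noise. If \<open>\<rho>\<close> solves the fixed-point
  equation equivalent to the sum-rate condition (with \<open>x = \<surd>P1\<close>, \<open>y = \<surd>P2\<close>), their variances
  stay 1 and their correlation stays \<open>\<rho>\<close>, while every channel use divides the error variance
  of the estimate of message \<open>i\<close> by \<open>r\<^sub>i = 1 + P\<^sub>i (1 - \<rho>\<^sup>2) / \<sigma>\<^sup>2\<close>. Chebyshev's inequality
  bounds the error probability by a constant times \<open>M\<^sub>i\<^sup>2 / (a\<^sup>2 r\<^sub>i\<^sup>n)\<close>, which is \<open>O(1 / a\<^sup>2)\<close>
  at rate \<open>R\<^sub>i = log r\<^sub>i / 2\<close>. With \<open>a\<^sup>2 = \<surd>n\<close> this vanishes, while the energy spent on the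
  message points and on the cancellation is \<open>o(n)\<close>.
\<close>

lemma square_sum_mult_le:
  fixes w v :: "'a \<Rightarrow> real"
  shows "(\<Sum>i\<in>I. w i * v i)\<^sup>2 \<le> (\<Sum>i\<in>I. \<bar>w i\<bar>) * (\<Sum>i\<in>I. \<bar>w i\<bar> * (v i)\<^sup>2)"
proof -
  have "(\<Sum>i\<in>I. w i * v i) = (\<Sum>i\<in>I. sqrt \<bar>w i\<bar> * (sqrt \<bar>w i\<bar> * sgn (w i) * v i))"
    by (intro sum.cong refl) (simp add: mult.assoc[symmetric] abs_mult_sgn)
  then have "(\<Sum>i\<in>I. w i * v i)\<^sup>2 = (\<Sum>i\<in>I. sqrt \<bar>w i\<bar> * (sqrt \<bar>w i\<bar> * sgn (w i) * v i))\<^sup>2"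
    by simp
  also have "\<dots> \<le> (\<Sum>i\<in>I. (sqrt \<bar>w i\<bar>)\<^sup>2) * (\<Sum>i\<in>I. (sqrt \<bar>w i\<bar> * sgn (w i) * v i)\<^sup>2)"
    by (rule Cauchy_Schwarz_ineq_sum)
  also have "\<dots> = (\<Sum>i\<in>I. \<bar>w i\<bar>) * (\<Sum>i\<in>I. \<bar>w i\<bar> * (v i)\<^sup>2)"
    by (intro arg_cong2[where f="(*)"] sum.cong refl) (auto simp: power_mult_distrib sgn_if)
  finally show ?thesis .
qed

lemma
  fixes D :: "real measure" and I :: "'i set"
  assumes D: "prob_space D" and int1: "integrable D (\<lambda>v. v)" and int2: "integrable D (\<lambda>v. v * v)"
    and mean: "(\<integral>v. v \<partial>D) = 0" and I: "finite I" and ij: "i \<in> I" "j \<in> I"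
  shows integrable_PiM_mult_components: "integrable (PiM I (\<lambda>_. D)) (\<lambda>z. z i * z j)"
    and integral_PiM_mult_components:
      "(\<integral>z. z i * z j \<partial>PiM I (\<lambda>_. D)) = (if i = j then \<integral>v. v * v \<partial>D else 0)"
proof -
  interpret D: prob_space D by (rule D)
  interpret product_sigma_finite "\<lambda>_. D"
    by (simp add: product_sigma_finite_def D.sigma_finite_measure_axioms)
  txt \<open>Write \<open>z i * z j\<close> as a product with one factor per coordinate.\<close>
  define f where "f l = (\<lambda>v. (if l = i then v else 1) * (if l = j then v else (1::real)))" for l
  have f_int: "integrable D (f l)" for l
    by (cases "l = i"; cases "l = j") (simp_all add: f_def int1 int2)
  have f_prod: "(\<Prod>l\<in>I. f l (z l)) = z i * z j" for z
    using ij I by (simp add: f_def prod.distrib prod.delta)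
  show "integrable (PiM I (\<lambda>_. D)) (\<lambda>z. z i * z j)"
    using product_integrable_prod[OF I, where f=f, OF f_int] by (simp add: f_prod)
  have "(\<integral>z. z i * z j \<partial>PiM I (\<lambda>_. D)) = (\<Prod>l\<in>I. \<integral>v. f l v \<partial>D)"
    using product_integral_prod[OF I, where f=f, OF f_int] by (simp add: f_prod)
  also have "\<dots> = (if i = j then \<integral>v. v * v \<partial>D else 0)"
  proof (cases "i = j")
    case True
    have "(\<Prod>l\<in>I. \<integral>v. f l v \<partial>D) = (\<Prod>l\<in>I. if l = i then \<integral>v. v * v \<partial>D else 1)"
      using True D.prob_space by (intro prod.cong) (auto simp: f_def)
    then show ?thesis
      using True I ij by (simp add: prod.delta)
  next
    case False
    then have "\<integral>v. f i v \<partial>D = 0"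
      by (simp add: f_def mean)
    then show ?thesis
      using False I ij by (simp add: prod_zero_iff) blast
  qed
  finally show "(\<integral>z. z i * z j \<partial>PiM I (\<lambda>_. D)) = (if i = j then \<integral>v. v * v \<partial>D else 0)" .
qed

lemma
  fixes D :: "real measure" and I :: "'i set"
  assumes D: "prob_space D" "integrable D (\<lambda>v. v)" "integrable D (\<lambda>v. v * v)" "(\<integral>v. v \<partial>D) = 0"
    and I: "finite I"
  shows integrable_square_lincomb_iid: "integrable (PiM I (\<lambda>_. D)) (\<lambda>z. (\<Sum>j\<in>I. c j * z j)\<^sup>2)"
    and integral_square_lincomb_iid:
      "(\<integral>z. (\<Sum>j\<in>I. c j * z j)\<^sup>2 \<partial>PiM I (\<lambda>_. D)) = (\<integral>v. v * v \<partial>D) * (\<Sum>j\<in>I. (c j)\<^sup>2)"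
proof -
  have expand: "(\<Sum>j\<in>I. c j * z j)\<^sup>2 = (\<Sum>i\<in>I. \<Sum>j\<in>I. c i * c j * (z i * z j))" for z :: "'i \<Rightarrow> real"
    by (simp add: power2_eq_square sum_product algebra_simps)
  have pair_int: "integrable (PiM I (\<lambda>_. D)) (\<lambda>z. z i * z j)" if "i \<in> I" "j \<in> I" for i j
    using D I that by (rule integrable_PiM_mult_components)
  show "integrable (PiM I (\<lambda>_. D)) (\<lambda>z. (\<Sum>j\<in>I. c j * z j)\<^sup>2)"
    unfolding expand by (intro Bochner_Integration.integrable_sum integrable_mult_right pair_int)
  have "(\<integral>z. (\<Sum>j\<in>I. c j * z j)\<^sup>2 \<partial>PiM I (\<lambda>_. D))
      = (\<Sum>i\<in>I. \<Sum>j\<in>I. c i * c j * (if i = j then \<integral>v. v * v \<partial>D else 0))"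
    unfolding expand using D I
    by (simp add: integral_PiM_mult_components pair_int Bochner_Integration.integrable_sum
        integrable_mult_right cong: sum.cong)
  also have "\<dots> = (\<integral>v. v * v \<partial>D) * (\<Sum>j\<in>I. (c j)\<^sup>2)"
    using I by (simp add: if_distrib[of "\<lambda>t. _ * t"] sum.delta sum_distrib_left power2_eq_square
        algebra_simps cong: if_cong)
  finally show "(\<integral>z. (\<Sum>j\<in>I. c j * z j)\<^sup>2 \<partial>PiM I (\<lambda>_. D)) = (\<integral>v. v * v \<partial>D) * (\<Sum>j\<in>I. (c j)\<^sup>2)" .
qed

lemma
  assumes "\<sigma> > 0"
  shows prob_space_normal_zero: "prob_space (density lborel (normal_density 0 \<sigma>))"
    and integrable_normal_zero_id: "integrable (density lborel (normal_density 0 \<sigma>)) (\<lambda>v. v)"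
    and integral_normal_zero_id: "(\<integral>v. v \<partial>density lborel (normal_density 0 \<sigma>)) = 0"
    and integrable_normal_zero_square: "integrable (density lborel (normal_density 0 \<sigma>)) (\<lambda>v. v * v)"
    and integral_normal_zero_square: "(\<integral>v. v * v \<partial>density lborel (normal_density 0 \<sigma>)) = \<sigma>\<^sup>2"
proof -
  show "prob_space (density lborel (normal_density 0 \<sigma>))"
    using assms by (rule prob_space_normal_density)
  have m1: "has_bochner_integral lborel (\<lambda>v. normal_density 0 \<sigma> v * v) 0"
    using normal_moment_nz_1[OF assms, of 0] by simp
  have m2: "has_bochner_integral lborel (\<lambda>v. normal_density 0 \<sigma> v * (v * v)) (\<sigma>\<^sup>2)"
    using normal_moment_even[OF assms, of 0 1] by (simp add: power2_eq_square)
  show "integrable (density lborel (normal_density 0 \<sigma>)) (\<lambda>v. v)"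
    "(\<integral>v. v \<partial>density lborel (normal_density 0 \<sigma>)) = 0"
    using m1 by (simp_all add: integrable_density integral_density has_bochner_integral_iff)
  show "integrable (density lborel (normal_density 0 \<sigma>)) (\<lambda>v. v * v)"
    "(\<integral>v. v * v \<partial>density lborel (normal_density 0 \<sigma>)) = \<sigma>\<^sup>2"
    using m2 by (simp_all add: integrable_density integral_density has_bochner_integral_iff)
qed

corollary
  assumes "\<sigma> > 0" "finite I"
  shows integrable_square_lincomb_normal:
      "integrable (PiM I (\<lambda>_. density lborel (normal_density 0 \<sigma>))) (\<lambda>z. (\<Sum>j\<in>I. c j * z j)\<^sup>2)"
    and integral_square_lincomb_normal:
      "(\<integral>z. (\<Sum>j\<in>I. c j * z j)\<^sup>2 \<partial>PiM I (\<lambda>_. density lborel (normal_density 0 \<sigma>)))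
         = \<sigma>\<^sup>2 * (\<Sum>j\<in>I. (c j)\<^sup>2)"
  using integrable_square_lincomb_iid[of _ I c] integral_square_lincomb_iid[of _ I c]
    prob_space_normal_zero integrable_normal_zero_id integral_normal_zero_id
    integrable_normal_zero_square integral_normal_zero_square assms
  by simp_all

lemma nn_integral_PiM_component_square:
  assumes "prob_space D" "sets D = sets borel" "integrable D (\<lambda>v. v\<^sup>2)" "j \<in> I"
  shows "(\<integral>\<^sup>+z. ennreal ((z j)\<^sup>2) \<partial>PiM I (\<lambda>_. D)) = ennreal (\<integral>v. v\<^sup>2 \<partial>D)"
proof -
  note assms(2)[measurable_cong]
  have "(\<integral>\<^sup>+z. ennreal ((z j)\<^sup>2) \<partial>PiM I (\<lambda>_. D))
      = (\<integral>\<^sup>+v. ennreal (v\<^sup>2) \<partial>distr (PiM I (\<lambda>_. D)) D (\<lambda>z. z j))"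
    using assms(4) by (subst nn_integral_distr) auto
  also have "distr (PiM I (\<lambda>_. D)) D (\<lambda>z. z j) = D"
    by (rule distr_PiM_component) (use assms in auto)
  finally show ?thesis
    using assms(3) by (simp add: nn_integral_eq_integral)
qed

lemma nn_integral_square_lincomb_le:
  fixes D :: "real measure" and \<iota> :: "'a \<Rightarrow> 'i"
  assumes D: "prob_space D" "sets D = sets borel" "integrable D (\<lambda>v. v\<^sup>2)"
    and J: "finite J" "\<iota> ` J \<subseteq> I"
  shows "(\<integral>\<^sup>+z. ennreal ((\<Sum>m\<in>J. c m * z (\<iota> m))\<^sup>2) \<partial>PiM I (\<lambda>_. D))
           \<le> ennreal ((\<Sum>m\<in>J. \<bar>c m\<bar>)\<^sup>2 * (\<integral>v. v\<^sup>2 \<partial>D))"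
proof -
  note D(2)[measurable_cong]
  define W where "W = (\<Sum>m\<in>J. \<bar>c m\<bar>)"
  have W: "W \<ge> 0" unfolding W_def by (simp add: sum_nonneg)
  have pointwise: "ennreal ((\<Sum>m\<in>J. c m * z (\<iota> m))\<^sup>2)
      \<le> (\<Sum>m\<in>J. ennreal (W * \<bar>c m\<bar>) * ennreal ((z (\<iota> m))\<^sup>2))" for z :: "'i \<Rightarrow> real"
  proof -
    have "(\<Sum>m\<in>J. c m * z (\<iota> m))\<^sup>2 \<le> (\<Sum>m\<in>J. W * \<bar>c m\<bar> * (z (\<iota> m))\<^sup>2)"
      using square_sum_mult_le[of c "\<lambda>m. z (\<iota> m)" J] by (simp add: W_def sum_distrib_left mult.assoc)
    moreover have "(\<Sum>m\<in>J. ennreal (W * \<bar>c m\<bar> * (z (\<iota> m))\<^sup>2))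
        = ennreal (\<Sum>m\<in>J. W * \<bar>c m\<bar> * (z (\<iota> m))\<^sup>2)"
      using W by (intro sum_ennreal) simp
    ultimately show ?thesis
      using W by (simp add: ennreal_leI ennreal_mult'[symmetric] mult.assoc)
  qed
  have "(\<integral>\<^sup>+z. ennreal ((\<Sum>m\<in>J. c m * z (\<iota> m))\<^sup>2) \<partial>PiM I (\<lambda>_. D))
      \<le> (\<integral>\<^sup>+z. (\<Sum>m\<in>J. ennreal (W * \<bar>c m\<bar>) * ennreal ((z (\<iota> m))\<^sup>2)) \<partial>PiM I (\<lambda>_. D))"
    by (intro nn_integral_mono pointwise)
  also have "\<dots> = (\<Sum>m\<in>J. ennreal (W * \<bar>c m\<bar>) * ennreal (\<integral>v. v\<^sup>2 \<partial>D))"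
    using J D
    by (simp add: nn_integral_sum nn_integral_cmult nn_integral_PiM_component_square image_subset_iff)
  also have "\<dots> = ennreal (\<Sum>m\<in>J. W * \<bar>c m\<bar> * (\<integral>v. v\<^sup>2 \<partial>D))"
    using W by (subst sum_ennreal[symmetric]) (simp_all add: ennreal_mult)
  also have "(\<Sum>m\<in>J. W * \<bar>c m\<bar> * (\<integral>v. v\<^sup>2 \<partial>D)) = W\<^sup>2 * (\<integral>v. v\<^sup>2 \<partial>D)"
    by (simp add: W_def power2_eq_square sum_distrib_left sum_distrib_right)
  finally show ?thesis unfolding W_def .
qed

lemma distr_pair_snd:
  assumes "prob_space M1" "sigma_finite_measure M2"
  shows "distr (M1 \<Otimes>\<^sub>M M2) M2 snd = M2"
proof -
  interpret M1: prob_space M1 by (rule assms(1))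
  interpret pair_sigma_finite M1 M2
    by (simp add: pair_sigma_finite_def assms(2) M1.sigma_finite_measure_axioms)
  have "distr (M1 \<Otimes>\<^sub>M M2) M2 snd = distr (distr (M2 \<Otimes>\<^sub>M M1) (M1 \<Otimes>\<^sub>M M2) (\<lambda>(x, y). (y, x))) M2 snd"
    by (simp flip: distr_pair_swap)
  also have "\<dots> = distr (M2 \<Otimes>\<^sub>M M1) M2 fst"
    by (subst distr_distr) (auto intro!: distr_cong)
  also have "\<dots> = M2"
    by (rule M1.distr_pair_fst)
  finally show ?thesis .
qed

lemma telescoping_estimate:
  fixes e c :: "nat \<Rightarrow> real"
  assumes "q \<noteq> 0" "\<And>m. m < K \<Longrightarrow> e (Suc m) = q * (e m - b * c m)"
  shows "\<kappa> * e 0 - (\<Sum>m<K. \<kappa> * b / q ^ m * c m) = \<kappa> * e K / q ^ K"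
  using assms(2)
proof (induction K)
  case (Suc K)
  then have "\<kappa> * e 0 - (\<Sum>m<Suc K. \<kappa> * b / q ^ m * c m) = \<kappa> * e K / q ^ K - \<kappa> * b / q ^ K * c K"
    by simp
  also have "\<dots> = \<kappa> * (e K - b * c K) / q ^ K"
    by (simp add: right_diff_distrib diff_divide_distrib)
  also have "e K - b * c K = e (Suc K) / q"
    using Suc.prems[of K] assms(1) by (simp add: field_simps)
  finally show ?case
    by simp
qed simp

lemma sum_two_points:
  fixes n :: nat and A B :: real
  shows "1 < n \<Longrightarrow> (\<Sum>j<n. if j = 0 then A else if j = 1 then B else 0) = A + B"
  by (induction n) (auto simp: less_Suc_eq)

lemma sum_lessThan_split2:
  fixes f :: "nat \<Rightarrow> 'a :: comm_monoid_add"
  assumes "2 \<le> n"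
  shows "(\<Sum>k<n. f k) = f 0 + f 1 + (\<Sum>m<n - 2. f (m + 2))"
proof -
  obtain n' where n: "n = Suc (Suc n')"
    using assms by (metis add_2_eq_Suc le_Suc_ex)
  show ?thesis
    unfolding n sum.lessThan_Suc_shift by (simp add: add.assoc)
qed

lemma eventually_sqrt_le: "0 < \<epsilon> \<Longrightarrow> eventually (\<lambda>n. 2 * sqrt (real n) + C \<le> real n * \<epsilon>) sequentially"
  by real_asymp

lemma tendsto_const_over_sqrt: "(\<lambda>n. K / sqrt (real n)) \<longlonglongrightarrow> 0"
  by real_asymp

lemma msgs_error_term_le:
  assumes "1 \<le> r" "2 \<le> n" "(real M)\<^sup>2 \<le> 4 * r ^ n" "0 \<le> \<kappa>" "0 < a"
  shows "4 * (real M)\<^sup>2 * (\<kappa> / (a\<^sup>2 * r ^ (n - 2))) \<le> 16 * \<kappa> * r\<^sup>2 / a\<^sup>2"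
proof -
  have "r ^ n = r\<^sup>2 * r ^ (n - 2)"
    using assms(2) by (metis le_add_diff_inverse power_add)
  then have "4 * (real M)\<^sup>2 * (\<kappa> / (a\<^sup>2 * r ^ (n - 2))) \<le> 4 * (4 * (r\<^sup>2 * r ^ (n - 2))) * (\<kappa> / (a\<^sup>2 * r ^ (n - 2)))"
    using assms by (intro mult_right_mono) (auto intro: divide_nonneg_pos)
  also have "\<dots> = 16 * \<kappa> * r\<^sup>2 / a\<^sup>2"
    using assms by (simp add: field_simps)
  finally show ?thesis .
qed

lemma mac_outs_eq_map:
  assumes "\<And>k'. k' < k \<Longrightarrow> f1 k' w1 s (\<lambda>j. if j < k' then Y j else 0)
            + f2 k' w2 s (\<lambda>j. if j < k' then Y j else 0) + s k' + z k' = Y k'"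
  shows "mac_outs f1 f2 w1 w2 s z k = map Y [0..<k]"
  using assms
proof (induction k)
  case (Suc k)
  have "(\<lambda>j. if j < k then map Y [0..<k] ! j else 0) = (\<lambda>j. if j < k then Y j else 0)"
    by auto
  with Suc show ?case by (simp add: Let_def)
qed simp

lemma past_out_eqI:
  assumes "\<And>k'. k' < k \<Longrightarrow> f1 k' w1 s (\<lambda>j. if j < k' then Y j else 0)
            + f2 k' w2 s (\<lambda>j. if j < k' then Y j else 0) + s k' + z k' = Y k'"
  shows "past_out f1 f2 w1 w2 s z k = (\<lambda>j. if j < k then Y j else 0)"
proof -
  have "mac_outs f1 f2 w1 w2 s z k = map Y [0..<k]"
    by (rule mac_outs_eq_map) (rule assms)
  then show ?thesis by (auto simp: past_out_def)
qed

lemma num_msgs_pos: "0 < num_msgs R n"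
  by (simp add: num_msgs_def)

lemma num_msgs_square_le:
  assumes "r \<ge> 1"
  shows "(real (num_msgs (1/2 * log 2 r) n))\<^sup>2 \<le> 4 * r ^ n"
proof -
  define p where "p = 2 powr (real n * (1/2 * log 2 r))"
  have "p \<ge> 1"
    using assms by (simp add: p_def ge_one_powr_ge_zero)
  have "real (num_msgs (1/2 * log 2 r) n) \<le> p + 1"
    by (simp add: num_msgs_def p_def)
  also have "\<dots> \<le> 2 * p" using \<open>p \<ge> 1\<close> by simp
  finally have "(real (num_msgs (1/2 * log 2 r) n))\<^sup>2 \<le> 4 * p\<^sup>2"
    using power_mono[of _ "2 * p" 2] by (simp add: power_mult_distrib)
  also have "p\<^sup>2 = (2 powr (log 2 r)) powr real n"
    by (simp add: p_def power2_eq_square powr_add[symmetric] powr_powr algebra_simps)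
  also have "\<dots> = r ^ n"
    using assms by (simp add: powr_realpow)
  finally show ?thesis .
qed

lemma error_prob_le:
  assumes "0 < M1" "0 < M2"
    and "\<And>w1 w2. w1 \<in> {1..M1} \<Longrightarrow> w2 \<in> {1..M2} \<Longrightarrow>
           measure (sample_space DS \<sigma> n) {\<omega> \<in> space (sample_space DS \<sigma> n).
             g (past_out f1 f2 w1 w2 (fst \<omega>) (snd \<omega>) n) \<noteq> (w1, w2)} \<le> e"
  shows "error_prob DS \<sigma> n M1 M2 f1 f2 g \<le> e"
proof -
  have "error_prob DS \<sigma> n M1 M2 f1 f2 g \<le> 1 / (real M1 * real M2) * (\<Sum>w1\<in>{1..M1}. \<Sum>w2\<in>{1..M2}. e)"
    unfolding error_prob_def using assms by (intro mult_left_mono sum_mono) auto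
  also have "\<dots> = e" using assms(1,2) by simp
  finally show ?thesis .
qed

lemma total_energy_le:
  assumes "\<And>w1 w2. w1 \<in> {1..M1} \<Longrightarrow> w2 \<in> {1..M2} \<Longrightarrow>
           (\<Sum>k<n. \<integral>\<^sup>+\<omega>. ennreal ((mac_input f f1 f2 (if first then w1 else w2) w1 w2 (fst \<omega>) (snd \<omega>) k)\<^sup>2)
              \<partial>sample_space DS \<sigma> n) \<le> ennreal E"
    and "0 \<le> E"
  shows "total_energy DS \<sigma> n M1 M2 f1 f2 f first \<le> ennreal (real M1 * real M2 * E)"
proof -
  have "total_energy DS \<sigma> n M1 M2 f1 f2 f first
      = (\<Sum>w1\<in>{1..M1}. \<Sum>w2\<in>{1..M2}. \<Sum>k<n. \<integral>\<^sup>+\<omega>.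
           ennreal ((mac_input f f1 f2 (if first then w1 else w2) w1 w2 (fst \<omega>) (snd \<omega>) k)\<^sup>2)
           \<partial>sample_space DS \<sigma> n)"
    unfolding total_energy_def by (subst sum.swap) (rule sum.cong[OF refl sum.swap])
  also have "\<dots> \<le> (\<Sum>w1\<in>{1..M1}. \<Sum>w2\<in>{1..M2}. ennreal E)"
    using assms(1) by (intro sum_mono) auto
  also have "\<dots> = ennreal (real M1 * real M2 * E)"
    using assms(2) by (simp add: ennreal_mult' ennreal_of_nat_eq_real_of_nat mult.assoc)
  finally show ?thesis .
qed

lemma achievable_zero_rates: "achievable DS \<sigma> P1 P2 0 0"
proof -
  let ?f = "\<lambda>(n::nat) (k::nat) (w::nat) (s::nat \<Rightarrow> real) (p::nat \<Rightarrow> real). 0::real"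
  have "num_msgs 0 n = 1" for n
    by (simp add: num_msgs_def)
  then show ?thesis
    unfolding achievable_def
    by (intro exI[of _ ?f] exI[of _ ?f] exI[of _ "\<lambda>_ _. (1, 1)"])
      (simp add: measurable_code_def total_energy_def mac_input_def error_prob_def)
qed

definition round_msg :: "nat \<Rightarrow> real \<Rightarrow> nat" where
  "round_msg M v = nat \<lfloor>real M * v + 1/2\<rfloor>"

lemma round_msg_eq:
  assumes "0 < M" "\<bar>v - real w / real M\<bar> < 1 / (2 * real M)"
  shows "round_msg M v = w"
proof -
  have "real M * v - real w = real M * (v - real w / real M)"
    using assms(1) by (simp add: field_simps)
  then have "\<bar>real M * v - real w\<bar> = real M * \<bar>v - real w / real M\<bar>"
    by (simp add: abs_mult)
  also have "\<dots> < 1/2"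
    using assms by (simp add: field_simps)
  finally have "\<bar>real M * v - real w\<bar> < 1/2" .
  then have "\<lfloor>real M * v + 1/2\<rfloor> = int w"
    by (intro floor_unique) arith+
  then show ?thesis by (simp add: round_msg_def)
qed

text \<open>The receiver's estimates of the messages, scaled by the amplitude, are statistics of
  this form.\<close>
definition lin_stat :: "nat \<Rightarrow> (nat \<Rightarrow> real) \<Rightarrow> nat \<Rightarrow> (nat \<Rightarrow> real) \<Rightarrow> real" where
  "lin_stat i g K yy = yy i - (\<Sum>m<K. g m * yy (m + 2))"

lemma lin_stat_add: "lin_stat i g K (\<lambda>j. u j + v j) = lin_stat i g K u + lin_stat i g K v"
  by (simp add: lin_stat_def sum.distrib algebra_simps)

lemma lin_stat_cong:
  assumes "i < 2" "\<And>j. j < K + 2 \<Longrightarrow> u j = v j"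
  shows "lin_stat i g K u = lin_stat i g K v"
  using assms by (auto simp: lin_stat_def intro!: sum.cong)

lemma lin_stat_eq_sum:
  "lin_stat i g K yy
     = (\<Sum>m<Suc K. (if m = 0 then 1 else - g (m - 1)) * yy (if m = 0 then i else m + 1))"
  unfolding sum.lessThan_Suc_shift by (simp add: lin_stat_def sum_negf)

text \<open>Message amplitude: \<open>amp n\<^sup>2 = \<surd>n\<close> is negligible against the block energy \<open>n P\<close>, yet it
  grows, which drives the error bound \<open>O(1 / amp n\<^sup>2)\<close> to zero.\<close>
definition amp :: "nat \<Rightarrow> real" where
  "amp n = sqrt (sqrt (real n))"

lemma energy_budget_le:
  assumes "2 * sqrt (real n) + C \<le> real n * \<epsilon>" "0 \<le> P"
  shows "2 * (amp n)\<^sup>2 + C + real (n - 2) * P \<le> real n * (P + \<epsilon>)"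
proof -
  have "real (n - 2) * P \<le> real n * P"
    using assms(2) by (intro mult_right_mono) auto
  then show ?thesis
    using assms(1) by (simp add: amp_def algebra_simps)
qed

section \<open>Ozarow's parameters\<close>

text \<open>\<open>N\<close> is the noise variance, \<open>x\<^sup>2\<close> and \<open>y\<^sup>2\<close> are the powers and \<open>\<rho>\<close> is the correlation of the two
  estimation errors that the scheme keeps stationary; \<open>fixed_point\<close> is the sum-rate
  condition \<open>r1 r2 = V / N\<close>. \<open>V\<close> is the variance of an output, \<open>b1\<close>, \<open>b2\<close> are the coefficients of the
  linear MMSE update and \<open>r1\<close>, \<open>r2\<close> the factors by which it divides the error variances.\<close>
locale ozarow =
  fixes N x y \<rho> :: real
  assumes N_pos: "0 < N" and x_nonneg: "0 \<le> x" and y_nonneg: "0 \<le> y"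
    and rho_nonneg: "0 \<le> \<rho>" and rho_less_1: "\<rho> < 1"
    and power_pos: "0 < x\<^sup>2 + y\<^sup>2"
    and fixed_point: "(N + x\<^sup>2 * (1 - \<rho>\<^sup>2)) * (N + y\<^sup>2 * (1 - \<rho>\<^sup>2)) = N * (x\<^sup>2 + y\<^sup>2 + 2 * \<rho> * x * y + N)"
begin

definition V where "V = x\<^sup>2 + y\<^sup>2 + 2 * \<rho> * x * y + N"
definition r1 where "r1 = 1 + x\<^sup>2 * (1 - \<rho>\<^sup>2) / N"
definition r2 where "r2 = 1 + y\<^sup>2 * (1 - \<rho>\<^sup>2) / N"
definition b1 where "b1 = (x + \<rho> * y) / V"
definition b2 where "b2 = (y + \<rho> * x) / V"

lemma one_minus_rho_sq_pos: "0 < 1 - \<rho>\<^sup>2"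
  using rho_nonneg rho_less_1 by (simp add: abs_square_less_1)

lemma V_gt_N: "N < V"
proof -
  have "0 < x\<^sup>2 + y\<^sup>2 + 2 * \<rho> * x * y"
    using power_pos x_nonneg y_nonneg rho_nonneg by (simp add: add_pos_nonneg)
  then show ?thesis by (simp add: V_def)
qed

lemma r1_ge_1: "1 \<le> r1"
  using N_pos one_minus_rho_sq_pos by (simp add: r1_def)

lemma r2_ge_1: "1 \<le> r2"
  using N_pos one_minus_rho_sq_pos by (simp add: r2_def)

lemma fixed_point_expanded:
  "((1 - \<rho>\<^sup>2) * x * y)\<^sup>2 = \<rho>\<^sup>2 * N * (x\<^sup>2 + y\<^sup>2) + 2 * \<rho> * N * x * y"
proof -
  have "((1 - \<rho>\<^sup>2) * x * y)\<^sup>2 - (\<rho>\<^sup>2 * N * (x\<^sup>2 + y\<^sup>2) + 2 * \<rho> * N * x * y)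
      = (N + x\<^sup>2 * (1 - \<rho>\<^sup>2)) * (N + y\<^sup>2 * (1 - \<rho>\<^sup>2)) - N * (x\<^sup>2 + y\<^sup>2 + 2 * \<rho> * x * y + N)"
    by (simp add: power2_eq_square algebra_simps)
  then show ?thesis
    using fixed_point by simp
qed

lemma r1_eq: "r1 = (N + x\<^sup>2 * (1 - \<rho>\<^sup>2)) / N"
  using N_pos by (simp add: r1_def add_divide_distrib)

lemma r2_eq: "r2 = (N + y\<^sup>2 * (1 - \<rho>\<^sup>2)) / N"
  using N_pos by (simp add: r2_def add_divide_distrib)

lemma r1_mult: "r1 * (N + y\<^sup>2 * (1 - \<rho>\<^sup>2)) = V"
  using fixed_point N_pos by (simp add: r1_eq V_def)

lemma r2_mult: "r2 * (N + x\<^sup>2 * (1 - \<rho>\<^sup>2)) = V"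
  using fixed_point N_pos by (simp add: r2_eq V_def mult.commute)

lemma r1_b1: "r1 * (1 - b1\<^sup>2 * V) = 1"
proof -
  have "V - (x + \<rho> * y)\<^sup>2 = N + y\<^sup>2 * (1 - \<rho>\<^sup>2)"
    by (simp add: V_def power2_eq_square algebra_simps)
  moreover have "1 - b1\<^sup>2 * V = (V - (x + \<rho> * y)\<^sup>2) / V"
    using V_gt_N N_pos by (simp add: b1_def field_simps power2_eq_square)
  ultimately have "1 - b1\<^sup>2 * V = (N + y\<^sup>2 * (1 - \<rho>\<^sup>2)) / V"
    by simp
  then show ?thesis
    using r1_mult V_gt_N N_pos by simp
qed

lemma r2_b2: "r2 * (1 - b2\<^sup>2 * V) = 1"
proof -
  have "V - (y + \<rho> * x)\<^sup>2 = N + x\<^sup>2 * (1 - \<rho>\<^sup>2)"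
    by (simp add: V_def power2_eq_square algebra_simps)
  moreover have "1 - b2\<^sup>2 * V = (V - (y + \<rho> * x)\<^sup>2) / V"
    using V_gt_N N_pos by (simp add: b2_def field_simps power2_eq_square)
  ultimately have "1 - b2\<^sup>2 * V = (N + x\<^sup>2 * (1 - \<rho>\<^sup>2)) / V"
    by simp
  then show ?thesis
    using r2_mult V_gt_N N_pos by simp
qed

lemma b1_V: "b1 * V = x + \<rho> * y"
  using V_gt_N N_pos by (simp add: b1_def)

lemma b2_V: "b2 * V = y + \<rho> * x"
  using V_gt_N N_pos by (simp add: b2_def)

text \<open>The fixed-point equation is quadratic in \<open>\<rho>\<close>; it forces the root with
  \<open>(1 - \<rho>\<^sup>2) x y \<ge> \<rho> N\<close>, which is what makes the correlation reproduce itself.\<close>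
lemma fixed_point_root: "(1 - \<rho>\<^sup>2) * x * y - \<rho> * N = \<rho> * sqrt (N * V)"
proof -
  define A where "A = (1 - \<rho>\<^sup>2) * x * y - \<rho> * N"
  have "A\<^sup>2 - \<rho>\<^sup>2 * N * V = ((1 - \<rho>\<^sup>2) * x * y)\<^sup>2 - (\<rho>\<^sup>2 * N * (x\<^sup>2 + y\<^sup>2) + 2 * \<rho> * N * x * y)"
    by (simp add: A_def V_def power2_eq_square algebra_simps)
  then have A_sq: "A\<^sup>2 = \<rho>\<^sup>2 * N * V"
    using fixed_point_expanded by simp
  have "0 \<le> A"
  proof (rule ccontr)
    assume "\<not> 0 \<le> A"
    moreover have "0 \<le> (1 - \<rho>\<^sup>2) * x * y"
      using one_minus_rho_sq_pos x_nonneg y_nonneg by simp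
    ultimately have neg: "0 < - A" "- A \<le> \<rho> * N" and "\<rho> \<noteq> 0"
      by (auto simp: A_def)
    then have "0 < \<rho>"
      using rho_nonneg by simp
    have "A\<^sup>2 \<le> (\<rho> * N)\<^sup>2"
      using power_mono[of "- A" "\<rho> * N" 2] neg by simp
    also have "\<dots> < \<rho>\<^sup>2 * N * V"
      using \<open>0 < \<rho>\<close> N_pos V_gt_N by (simp add: power2_eq_square)
    finally show False
      using A_sq by simp
  qed
  moreover have "A\<^sup>2 = (\<rho> * sqrt (N * V))\<^sup>2"
    using A_sq N_pos V_gt_N by (simp add: power_mult_distrib)
  ultimately show ?thesis
    unfolding A_def[symmetric] using rho_nonneg N_pos V_gt_N by (subst (asm) power2_eq_iff_nonneg) auto
qed

lemma sqrt_r1_r2_b1_b2: "sqrt r1 * sqrt r2 * (\<rho> - b1 * b2 * V) = - \<rho>"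
proof -
  have "\<rho> * V - (x + \<rho> * y) * (y + \<rho> * x) = - ((1 - \<rho>\<^sup>2) * x * y - \<rho> * N)"
    by (simp add: V_def power2_eq_square algebra_simps)
  moreover have "\<rho> - b1 * b2 * V = (\<rho> * V - (x + \<rho> * y) * (y + \<rho> * x)) / V"
    using V_gt_N N_pos by (simp add: b1_def b2_def field_simps)
  ultimately have "\<rho> - b1 * b2 * V = - (\<rho> * sqrt (N * V)) / V"
    by (simp add: fixed_point_root)
  moreover have "sqrt r1 * sqrt r2 = sqrt (V / N)"
    using r1_mult by (simp add: r2_eq flip: real_sqrt_mult)
  ultimately have "sqrt r1 * sqrt r2 * (\<rho> - b1 * b2 * V) = sqrt (V / N) * (- (\<rho> * sqrt (N * V)) / V)"
    by (simp only:)
  also have "\<dots> = - \<rho> * (sqrt (V / N) * sqrt (N * V)) / V"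
    by (simp add: field_simps)
  also have "sqrt (V / N) * sqrt (N * V) = V"
    using V_gt_N N_pos by (simp flip: real_sqrt_mult)
  finally show ?thesis
    using V_gt_N N_pos by simp
qed

lemma r1_gt_1: "b1 \<noteq> 0 \<Longrightarrow> 1 < r1"
proof (rule ccontr)
  assume "b1 \<noteq> 0" "\<not> 1 < r1"
  then have "r1 = 1" using r1_ge_1 by simp
  then have "x = 0"
    using N_pos one_minus_rho_sq_pos by (simp add: r1_def)
  moreover have "N + y\<^sup>2 * (1 - \<rho>\<^sup>2) = x\<^sup>2 + y\<^sup>2 + 2 * \<rho> * x * y + N"
    using r1_mult \<open>r1 = 1\<close> by (simp add: V_def)
  ultimately have "\<rho> * y = 0"
    by (simp add: algebra_simps power2_eq_square)
  with \<open>x = 0\<close> have "b1 * V = 0"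
    by (subst b1_V) simp
  with \<open>b1 \<noteq> 0\<close> show False
    using V_gt_N N_pos by simp
qed

lemma r2_gt_1: "b2 \<noteq> 0 \<Longrightarrow> 1 < r2"
proof (rule ccontr)
  assume "b2 \<noteq> 0" "\<not> 1 < r2"
  then have "r2 = 1" using r2_ge_1 by simp
  then have "y = 0"
    using N_pos one_minus_rho_sq_pos by (simp add: r2_def)
  moreover have "N + x\<^sup>2 * (1 - \<rho>\<^sup>2) = x\<^sup>2 + y\<^sup>2 + 2 * \<rho> * x * y + N"
    using r2_mult \<open>r2 = 1\<close> by (simp add: V_def)
  ultimately have "\<rho> * x = 0"
    by (simp add: algebra_simps power2_eq_square)
  with \<open>y = 0\<close> have "b2 * V = 0"
    by (subst b2_V) simp
  with \<open>b2 \<noteq> 0\<close> show False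
    using V_gt_N N_pos by simp
qed

text \<open>\<open>cov n u v\<close> is the covariance of the linear forms \<open>\<Sum>j<n. u j * Z j\<close> and \<open>\<Sum>j<n. v j * Z j\<close>
  of i.i.d. noise samples of variance \<open>N\<close>.\<close>
definition cov :: "nat \<Rightarrow> (nat \<Rightarrow> real) \<Rightarrow> (nat \<Rightarrow> real) \<Rightarrow> real" where
  "cov n u v = N * (\<Sum>j<n. u j * v j)"

lemma cov_commute: "cov n u v = cov n v u"
  by (simp add: cov_def mult.commute)

lemma cov_update:
  "cov n (\<lambda>j. \<alpha> * (u j - \<beta> * c j)) (\<lambda>j. \<gamma> * (v j - \<delta> * c j))
     = \<alpha> * \<gamma> * (cov n u v - \<delta> * cov n u c - \<beta> * cov n c v + \<beta> * \<delta> * cov n c c)"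
proof -
  have "(\<Sum>j<n. \<alpha> * (u j - \<beta> * c j) * (\<gamma> * (v j - \<delta> * c j)))
      = (\<Sum>j<n. \<alpha> * \<gamma> * (u j * v j) - \<alpha> * \<gamma> * \<delta> * (u j * c j) - \<alpha> * \<gamma> * \<beta> * (c j * v j)
               + \<alpha> * \<gamma> * \<beta> * \<delta> * (c j * c j))"
    by (intro sum.cong refl) (simp add: algebra_simps)
  then show ?thesis
    by (simp add: cov_def sum.distrib sum_subtractf sum_distrib_left[symmetric] algebra_simps)
qed

definition out_coeffs :: "nat \<Rightarrow> (nat \<Rightarrow> real) \<times> (nat \<Rightarrow> real) \<Rightarrow> nat \<Rightarrow> real" where
  "out_coeffs k uw j = x * fst uw j + y * snd uw j + (if j = k then 1 else 0)"

lemma cov_out_coeffs: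
  assumes "k < n"
  shows "cov n v (out_coeffs k uw) = x * cov n v (fst uw) + y * cov n v (snd uw) + N * v k"
proof -
  have "(\<Sum>j<n. v j * out_coeffs k uw j)
      = x * (\<Sum>j<n. v j * fst uw j) + y * (\<Sum>j<n. v j * snd uw j) + (\<Sum>j<n. if j = k then v k else 0)"
    by (simp add: out_coeffs_def sum.distrib sum_distrib_left algebra_simps if_distrib[of "\<lambda>t. _ * t"] cong: if_cong)
  then show ?thesis
    using assms by (simp add: cov_def algebra_simps)
qed

definition standardized :: "nat \<Rightarrow> (nat \<Rightarrow> real) \<times> (nat \<Rightarrow> real) \<Rightarrow> bool" where
  "standardized n uw \<longleftrightarrow>
     cov n (fst uw) (fst uw) = 1 \<and> cov n (snd uw) (snd uw) = 1 \<and> cov n (fst uw) (snd uw) = \<rho>"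

definition err_update :: "nat \<Rightarrow> (nat \<Rightarrow> real) \<times> (nat \<Rightarrow> real) \<Rightarrow> (nat \<Rightarrow> real) \<times> (nat \<Rightarrow> real)" where
  "err_update k uw =
     (\<lambda>j. sqrt r1 * (fst uw j - b1 * out_coeffs k uw j),
      \<lambda>j. - sqrt r2 * (snd uw j - b2 * out_coeffs k uw j))"

lemma cov_out_coeffs_values:
  assumes "standardized n (u, w)" "k < n" "u k = 0" "w k = 0"
  shows "cov n u (out_coeffs k (u, w)) = b1 * V" "cov n w (out_coeffs k (u, w)) = b2 * V"
    and "cov n (out_coeffs k (u, w)) (out_coeffs k (u, w)) = V"
proof -
  define c where "c = out_coeffs k (u, w)"
  have uu: "cov n u u = 1" and ww: "cov n w w = 1" and uw: "cov n u w = \<rho>"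
    using assms(1) by (simp_all add: standardized_def)
  show uc: "cov n u (out_coeffs k (u, w)) = b1 * V"
    using assms(2,3) uu uw by (simp add: cov_out_coeffs b1_V)
  show wc: "cov n w (out_coeffs k (u, w)) = b2 * V"
    using assms(2,4) ww uw by (simp add: cov_out_coeffs b2_V cov_commute[of n w u])
  have "c k = 1"
    using assms(3,4) by (simp add: c_def out_coeffs_def)
  moreover have "cov n c c = x * cov n c u + y * cov n c w + N * c k"
    using cov_out_coeffs[OF assms(2), of c "(u, w)"] by (simp add: c_def)
  moreover have "cov n c u = x + \<rho> * y" "cov n c w = y + \<rho> * x"
    using uc wc by (simp_all add: c_def cov_commute b1_V b2_V)
  ultimately have "cov n c c = x * (x + \<rho> * y) + y * (y + \<rho> * x) + N"
    by simp
  then show "cov n (out_coeffs k (u, w)) (out_coeffs k (u, w)) = V"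
    by (simp add: c_def V_def power2_eq_square algebra_simps)
qed

lemma standardized_err_update:
  assumes "standardized n (u, w)" "k < n" "u k = 0" "w k = 0"
  shows "standardized n (err_update k (u, w))"
proof -
  define c where "c = out_coeffs k (u, w)"
  have uu: "cov n u u = 1" and ww: "cov n w w = 1" and uw: "cov n u w = \<rho>"
    using assms(1) by (simp_all add: standardized_def)
  have uc: "cov n u c = b1 * V" and wc: "cov n w c = b2 * V" and cc: "cov n c c = V"
    using cov_out_coeffs_values[OF assms] by (simp_all add: c_def)
  then have cu: "cov n c u = b1 * V" and cw: "cov n c w = b2 * V"
    by (simp_all add: cov_commute)
  have "cov n (\<lambda>j. sqrt r1 * (u j - b1 * c j)) (\<lambda>j. sqrt r1 * (u j - b1 * c j)) = r1 * (1 - b1\<^sup>2 * V)"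
    unfolding cov_update uu uc cu cc using r1_ge_1 by (simp add: power2_eq_square algebra_simps)
  moreover have "cov n (\<lambda>j. - sqrt r2 * (w j - b2 * c j)) (\<lambda>j. - sqrt r2 * (w j - b2 * c j))
      = r2 * (1 - b2\<^sup>2 * V)"
    unfolding cov_update ww wc cw cc using r2_ge_1 by (simp add: power2_eq_square algebra_simps)
  moreover have "cov n (\<lambda>j. sqrt r1 * (u j - b1 * c j)) (\<lambda>j. - sqrt r2 * (w j - b2 * c j))
      = - (sqrt r1 * sqrt r2 * (\<rho> - b1 * b2 * V))"
    unfolding cov_update uw uc cw cc by (simp add: algebra_simps)
  ultimately show ?thesis
    by (simp add: standardized_def err_update_def c_def[symmetric] r1_b1 r2_b2 sqrt_r1_r2_b1_b2)
qed

text \<open>Coefficients, with respect to the noise samples, of the normalised errors of the receiver's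
  estimates of the two messages after the first \<open>m + 2\<close> channel uses. The minus sign in the
  update of the second error keeps the correlation at \<open>+\<rho>\<close> (Ozarow alternates the sign of
  the second transmission instead).\<close>
primrec err_coeffs :: "nat \<Rightarrow> (nat \<Rightarrow> real) \<times> (nat \<Rightarrow> real)" where
  "err_coeffs 0 =
     (\<lambda>j. if j = 0 then 1 / sqrt N else 0,
      \<lambda>j. if j = 0 then \<rho> / sqrt N else if j = 1 then sqrt (1 - \<rho>\<^sup>2) / sqrt N else 0)"
| "err_coeffs (Suc m) = err_update (m + 2) (err_coeffs m)"

lemma err_coeffs_vanish: "m + 2 \<le> j \<Longrightarrow> fst (err_coeffs m) j = 0 \<and> snd (err_coeffs m) j = 0"
  by (induction m arbitrary: j) (auto simp: err_update_def out_coeffs_def)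

lemma standardized_err_coeffs: "m + 2 \<le> n \<Longrightarrow> standardized n (err_coeffs m)"
proof (induction m)
  case 0
  have sum_01: "(\<Sum>j<n. f j) = f 0 + f 1" if "\<And>j. 2 \<le> j \<Longrightarrow> f j = 0" for f :: "nat \<Rightarrow> real"
  proof -
    have "(\<Sum>j<n. f j) = (\<Sum>j<2. f j)"
      by (rule sum.mono_neutral_right) (use that 0 in auto)
    then show ?thesis by (simp add: numeral_2_eq_2)
  qed
  have "N * (\<rho> / sqrt N * (\<rho> / sqrt N) + sqrt (1 - \<rho>\<^sup>2) / sqrt N * (sqrt (1 - \<rho>\<^sup>2) / sqrt N)) = 1"
    using N_pos one_minus_rho_sq_pos by (simp add: power2_eq_square[symmetric] power_divide add_divide_distrib[symmetric])
  then show ?case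
    using N_pos by (simp add: standardized_def cov_def sum_01 power2_eq_square[symmetric] power_divide)
next
  case (Suc m)
  then show ?case
    using err_coeffs_vanish[of m "m + 2"]
      standardized_err_update[of n "fst (err_coeffs m)" "snd (err_coeffs m)" "m + 2"]
    by simp
qed

section \<open>The coding scheme\<close>

text \<open>At time 1 encoder 1, which has learned \<open>Z 0\<close> from the feedback, sends \<open>mu * Z 0\<close>, so that the
  initial errors of the two estimates are correlated with coefficient \<open>\<rho>\<close>.\<close>
definition mu :: real where
  "mu = \<rho> / sqrt (1 - \<rho>\<^sup>2)"

definition gain1 :: "nat \<Rightarrow> real" where
  "gain1 m = sqrt N * b1 / sqrt r1 ^ m"

definition gain2 :: "nat \<Rightarrow> real" where
  "gain2 m = sqrt N / sqrt (1 - \<rho>\<^sup>2) * b2 / (- sqrt r2) ^ m"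

lemma summable_abs_gain1: "summable (\<lambda>m. \<bar>gain1 m\<bar>)"
proof (cases "b1 = 0")
  case False
  then have "1 < r1" by (rule r1_gt_1)
  then have "summable (\<lambda>m. sqrt N * \<bar>b1\<bar> * (1 / sqrt r1) ^ m)"
    by (intro summable_mult summable_geometric) simp
  moreover have "\<bar>gain1 m\<bar> = sqrt N * \<bar>b1\<bar> * (1 / sqrt r1) ^ m" for m
    using N_pos \<open>1 < r1\<close> by (simp add: gain1_def abs_mult power_one_over divide_inverse power_inverse)
  ultimately show ?thesis by simp
qed (simp add: gain1_def)

lemma summable_abs_gain2: "summable (\<lambda>m. \<bar>gain2 m\<bar>)"
proof (cases "b2 = 0")
  case False
  then have "1 < r2" by (rule r2_gt_1)
  then have "summable (\<lambda>m. sqrt N / sqrt (1 - \<rho>\<^sup>2) * \<bar>b2\<bar> * (1 / sqrt r2) ^ m)"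
    by (intro summable_mult summable_geometric) simp
  moreover have "\<bar>gain2 m\<bar> = sqrt N / sqrt (1 - \<rho>\<^sup>2) * \<bar>b2\<bar> * (1 / sqrt r2) ^ m" for m
    using N_pos \<open>1 < r2\<close> one_minus_rho_sq_pos
    by (simp add: gain2_def abs_mult power_abs power_one_over divide_inverse power_inverse)
  ultimately show ?thesis by simp
qed (simp add: gain2_def)

definition gain_bound1 :: real where
  "gain_bound1 = (\<Sum>m. \<bar>gain1 m\<bar>)"

definition gain_bound2 :: real where
  "gain_bound2 = (\<Sum>m. \<bar>gain2 m\<bar>)"

lemma sum_abs_gain1_le: "(\<Sum>m<K. \<bar>gain1 m\<bar>) \<le> gain_bound1"
  unfolding gain_bound1_def using summable_abs_gain1 by (rule sum_le_suminf) auto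

lemma sum_abs_gain2_le: "(\<Sum>m<K. \<bar>gain2 m\<bar>) \<le> gain_bound2"
  unfolding gain_bound2_def using summable_abs_gain2 by (rule sum_le_suminf) auto

text \<open>The encoders add \<open>cancel n s 0\<close> and \<open>cancel n s 1\<close> to their first inputs. Since the decoder's
  statistics are linear and the state enters the outputs additively, this removes the state
  from them exactly (\<open>lin_stat_state_free\<close>).\<close>
definition cancel :: "nat \<Rightarrow> (nat \<Rightarrow> real) \<Rightarrow> nat \<Rightarrow> real" where
  "cancel n s j =
     (if j = 0 then - lin_stat 0 gain1 (n - 2) s
      else if j = 1 then - lin_stat 1 gain2 (n - 2) s
      else 0)"

lemma lin_stat_cancel: "i < 2 \<Longrightarrow> lin_stat i g K (cancel n s) = cancel n s i"
  by (simp add: lin_stat_def cancel_def)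

lemma lin_stat_state_free:
  "lin_stat 0 gain1 (n - 2) (\<lambda>j. yy j + s j + cancel n s j) = lin_stat 0 gain1 (n - 2) yy"
  "lin_stat 1 gain2 (n - 2) (\<lambda>j. yy j + s j + cancel n s j) = lin_stat 1 gain2 (n - 2) yy"
  by (simp_all add: lin_stat_add lin_stat_cancel) (simp_all add: cancel_def)

definition err1 :: "nat \<Rightarrow> nat \<Rightarrow> (nat \<Rightarrow> real) \<Rightarrow> real" where
  "err1 n m z = (\<Sum>j<n. fst (err_coeffs m) j * z j)"

definition err2 :: "nat \<Rightarrow> nat \<Rightarrow> (nat \<Rightarrow> real) \<Rightarrow> real" where
  "err2 n m z = (\<Sum>j<n. snd (err_coeffs m) j * z j)"

text \<open>The outputs with the state and its cancellation removed.\<close>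
definition clean_out :: "nat \<Rightarrow> real \<Rightarrow> real \<Rightarrow> real \<Rightarrow> (nat \<Rightarrow> real) \<Rightarrow> nat \<Rightarrow> real" where
  "clean_out n a \<theta>1 \<theta>2 z k =
     (if k = 0 then a * \<theta>1 + z 0
      else if k = 1 then a * \<theta>2 + mu * z 0 + z 1
      else x * err1 n (k - 2) z + y * err2 n (k - 2) z + z k)"

lemma sum_err_update:
  assumes "k < n"
  shows "(\<Sum>j<n. c * (v j - b * out_coeffs k (u, w) j) * z j)
     = c * ((\<Sum>j<n. v j * z j) - b * (x * (\<Sum>j<n. u j * z j) + y * (\<Sum>j<n. w j * z j) + z k))"
proof -
  have "(\<Sum>j<n. c * (v j - b * out_coeffs k (u, w) j) * z j)
      = (\<Sum>j<n. c * (v j * z j) - c * b * x * (u j * z j) - c * b * y * (w j * z j)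
               - (if j = k then c * b * z k else 0))"
    by (intro sum.cong refl) (simp add: out_coeffs_def algebra_simps)
  then show ?thesis
    using assms by (simp add: sum_subtractf sum.distrib sum_distrib_left[symmetric] algebra_simps)
qed

lemma err1_Suc:
  "m + 2 < n \<Longrightarrow> err1 n (Suc m) z = sqrt r1 * (err1 n m z - b1 * clean_out n a \<theta>1 \<theta>2 z (m + 2))"
  using sum_err_update[of "m + 2" n "sqrt r1" "fst (err_coeffs m)" b1 "fst (err_coeffs m)" "snd (err_coeffs m)" z]
  by (simp add: err1_def err2_def clean_out_def err_update_def)

lemma err2_Suc:
  "m + 2 < n \<Longrightarrow> err2 n (Suc m) z = - sqrt r2 * (err2 n m z - b2 * clean_out n a \<theta>1 \<theta>2 z (m + 2))"
  using sum_err_update[of "m + 2" n "- sqrt r2" "snd (err_coeffs m)" b2 "fst (err_coeffs m)" "snd (err_coeffs m)" z]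
  by (simp add: err1_def err2_def clean_out_def err_update_def)

lemma err1_0: "0 < n \<Longrightarrow> sqrt N * err1 n 0 z = z 0"
  using N_pos by (simp add: err1_def if_distrib[of "\<lambda>t. t * _"] cong: if_cong)

lemma err2_0: "1 < n \<Longrightarrow> sqrt N / sqrt (1 - \<rho>\<^sup>2) * err2 n 0 z = mu * z 0 + z 1"
proof -
  assume "1 < n"
  have "err2 n 0 z = (\<Sum>j<n. if j = 0 then \<rho> * z 0 / sqrt N else if j = 1 then sqrt (1 - \<rho>\<^sup>2) * z 1 / sqrt N else 0)"
    unfolding err2_def by (intro sum.cong) auto
  also have "\<dots> = (\<rho> * z 0 + sqrt (1 - \<rho>\<^sup>2) * z 1) / sqrt N"
    using \<open>1 < n\<close> by (simp only: sum_two_points add_divide_distrib)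
  finally have "err2 n 0 z = (\<rho> * z 0 + sqrt (1 - \<rho>\<^sup>2) * z 1) / sqrt N" .
  then show ?thesis
    using N_pos one_minus_rho_sq_pos by (simp add: mu_def field_simps)
qed

lemma lin_stat1_clean_out:
  assumes "K + 2 \<le> n"
  shows "lin_stat 0 gain1 K (clean_out n a \<theta>1 \<theta>2 z) = a * \<theta>1 + sqrt N * err1 n K z / sqrt r1 ^ K"
proof -
  have "sqrt N * err1 n 0 z - (\<Sum>m<K. sqrt N * b1 / sqrt r1 ^ m * clean_out n a \<theta>1 \<theta>2 z (m + 2))
      = sqrt N * err1 n K z / sqrt r1 ^ K"
    using r1_ge_1 assms err1_Suc[of _ n z a \<theta>1 \<theta>2] by (intro telescoping_estimate) auto
  then show ?thesis
    using assms err1_0[of n z] by (simp add: lin_stat_def gain1_def clean_out_def)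
qed

lemma lin_stat2_clean_out:
  assumes "K + 2 \<le> n"
  shows "lin_stat 1 gain2 K (clean_out n a \<theta>1 \<theta>2 z)
           = a * \<theta>2 + sqrt N / sqrt (1 - \<rho>\<^sup>2) * err2 n K z / (- sqrt r2) ^ K"
proof -
  have "sqrt N / sqrt (1 - \<rho>\<^sup>2) * err2 n 0 z
        - (\<Sum>m<K. sqrt N / sqrt (1 - \<rho>\<^sup>2) * b2 / (- sqrt r2) ^ m * clean_out n a \<theta>1 \<theta>2 z (m + 2))
      = sqrt N / sqrt (1 - \<rho>\<^sup>2) * err2 n K z / (- sqrt r2) ^ K"
    using r2_ge_1 assms err2_Suc[of _ n z a \<theta>1 \<theta>2] by (intro telescoping_estimate) auto
  then show ?thesis
    using assms err2_0[of n z] by (simp add: lin_stat_def gain2_def clean_out_def)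
qed

text \<open>From time 2 on, each encoder recomputes from the fed-back outputs the receiver's current
  estimation error of its own message (via \<open>lin_stat1_clean_out\<close>, \<open>lin_stat2_clean_out\<close>) and
  sends it, normalised and scaled to the power \<open>x\<^sup>2\<close> resp. \<open>y\<^sup>2\<close>.\<close>
definition enc1 :: "nat \<Rightarrow> real \<Rightarrow> nat \<Rightarrow> encoder" where
  "enc1 n a M k w s p =
     (let \<theta> = real w / real M; yy = (\<lambda>j. p j - s j - cancel n s j) in
      if k = 0 then a * \<theta> + cancel n s 0
      else if k = 1 then mu * (yy 0 - a * \<theta>)
      else x * sqrt r1 ^ (k - 2) * (lin_stat 0 gain1 (k - 2) yy - a * \<theta>) / sqrt N)"

definition enc2 :: "nat \<Rightarrow> real \<Rightarrow> nat \<Rightarrow> encoder" where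
  "enc2 n a M k w s p =
     (let \<theta> = real w / real M; yy = (\<lambda>j. p j - s j - cancel n s j) in
      if k = 0 then 0
      else if k = 1 then a * \<theta> + cancel n s 1
      else y * (- sqrt r2) ^ (k - 2) * (lin_stat 1 gain2 (k - 2) yy - a * \<theta>) * sqrt (1 - \<rho>\<^sup>2) / sqrt N)"

definition decoder :: "nat \<Rightarrow> real \<Rightarrow> nat \<Rightarrow> nat \<Rightarrow> (nat \<Rightarrow> real) \<Rightarrow> nat \<times> nat" where
  "decoder n a M1 M2 yy =
     (round_msg M1 (lin_stat 0 gain1 (n - 2) yy / a), round_msg M2 (lin_stat 1 gain2 (n - 2) yy / a))"

definition input1 :: "nat \<Rightarrow> real \<Rightarrow> real \<Rightarrow> (nat \<Rightarrow> real) \<Rightarrow> (nat \<Rightarrow> real) \<Rightarrow> nat \<Rightarrow> real" where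
  "input1 n a \<theta>1 s z k =
     (if k = 0 then a * \<theta>1 + cancel n s 0 else if k = 1 then mu * z 0 else x * err1 n (k - 2) z)"

definition input2 :: "nat \<Rightarrow> real \<Rightarrow> real \<Rightarrow> (nat \<Rightarrow> real) \<Rightarrow> (nat \<Rightarrow> real) \<Rightarrow> nat \<Rightarrow> real" where
  "input2 n a \<theta>2 s z k =
     (if k = 0 then 0 else if k = 1 then a * \<theta>2 + cancel n s 1 else y * err2 n (k - 2) z)"

definition channel_out :: "nat \<Rightarrow> real \<Rightarrow> real \<Rightarrow> real \<Rightarrow> (nat \<Rightarrow> real) \<Rightarrow> (nat \<Rightarrow> real) \<Rightarrow> nat \<Rightarrow> real" where
  "channel_out n a \<theta>1 \<theta>2 s z k = clean_out n a \<theta>1 \<theta>2 z k + s k + cancel n s k"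

lemma enc1_channel_out:
  assumes "k < n"
  shows "enc1 n a M1 k w1 s (\<lambda>j. if j < k then channel_out n a (real w1 / real M1) \<theta>2 s z j else 0)
           = input1 n a (real w1 / real M1) s z k"
proof -
  define \<theta>1 where "\<theta>1 = real w1 / real M1"
  define yy where "yy = (\<lambda>j. (if j < k then channel_out n a \<theta>1 \<theta>2 s z j else 0) - s j - cancel n s j)"
  have yy: "j < k \<Longrightarrow> yy j = clean_out n a \<theta>1 \<theta>2 z j" for j
    by (simp add: yy_def channel_out_def)
  have "enc1 n a M1 k w1 s (\<lambda>j. if j < k then channel_out n a \<theta>1 \<theta>2 s z j else 0) = input1 n a \<theta>1 s z k"
  proof (cases "k < 2")
    case True
    then show ?thesis
      using yy[of 0] by (auto simp: enc1_def input1_def yy_def[symmetric] \<theta>1_def[symmetric] clean_out_def)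
  next
    case False
    then have "lin_stat 0 gain1 (k - 2) yy = lin_stat 0 gain1 (k - 2) (clean_out n a \<theta>1 \<theta>2 z)"
      using yy by (intro lin_stat_cong) auto
    also have "\<dots> = a * \<theta>1 + sqrt N * err1 n (k - 2) z / sqrt r1 ^ (k - 2)"
      using False assms by (intro lin_stat1_clean_out) simp
    finally show ?thesis
      using False N_pos r1_ge_1 by (simp add: enc1_def input1_def yy_def[symmetric] \<theta>1_def[symmetric])
  qed
  then show ?thesis unfolding \<theta>1_def .
qed

lemma enc2_channel_out:
  assumes "k < n"
  shows "enc2 n a M2 k w2 s (\<lambda>j. if j < k then channel_out n a \<theta>1 (real w2 / real M2) s z j else 0)
           = input2 n a (real w2 / real M2) s z k"
proof -
  define \<theta>2 where "\<theta>2 = real w2 / real M2"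
  define yy where "yy = (\<lambda>j. (if j < k then channel_out n a \<theta>1 \<theta>2 s z j else 0) - s j - cancel n s j)"
  have yy: "j < k \<Longrightarrow> yy j = clean_out n a \<theta>1 \<theta>2 z j" for j
    by (simp add: yy_def channel_out_def)
  have "enc2 n a M2 k w2 s (\<lambda>j. if j < k then channel_out n a \<theta>1 \<theta>2 s z j else 0) = input2 n a \<theta>2 s z k"
  proof (cases "k < 2")
    case True
    then show ?thesis
      by (auto simp: enc2_def input2_def \<theta>2_def[symmetric])
  next
    case False
    then have "lin_stat 1 gain2 (k - 2) yy = lin_stat 1 gain2 (k - 2) (clean_out n a \<theta>1 \<theta>2 z)"
      using yy by (intro lin_stat_cong) auto
    also have "\<dots> = a * \<theta>2 + sqrt N / sqrt (1 - \<rho>\<^sup>2) * err2 n (k - 2) z / (- sqrt r2) ^ (k - 2)"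
      using False assms by (intro lin_stat2_clean_out) simp
    finally show ?thesis
      using False N_pos r2_ge_1 one_minus_rho_sq_pos
      by (simp add: enc2_def input2_def yy_def[symmetric] \<theta>2_def[symmetric])
  qed
  then show ?thesis unfolding \<theta>2_def .
qed

lemma past_out_code:
  assumes "k \<le> n"
  shows "past_out (enc1 n a M1) (enc2 n a M2) w1 w2 s z k
           = (\<lambda>j. if j < k then channel_out n a (real w1 / real M1) (real w2 / real M2) s z j else 0)"
  by (rule past_out_eqI)
    (use assms in \<open>simp add: enc1_channel_out enc2_channel_out input1_def input2_def channel_out_def clean_out_def cancel_def\<close>)

lemma mac_input_enc1:
  "k < n \<Longrightarrow> mac_input (enc1 n a M1) (enc1 n a M1) (enc2 n a M2) w1 w1 w2 s z k = input1 n a (real w1 / real M1) s z k"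
  by (simp add: mac_input_def past_out_code enc1_channel_out)

lemma mac_input_enc2:
  "k < n \<Longrightarrow> mac_input (enc2 n a M2) (enc1 n a M1) (enc2 n a M2) w2 w1 w2 s z k = input2 n a (real w2 / real M2) s z k"
  by (simp add: mac_input_def past_out_code enc2_channel_out)

definition err_scale1 :: "nat \<Rightarrow> real \<Rightarrow> real" where
  "err_scale1 n a = sqrt N / (a * sqrt r1 ^ (n - 2))"

definition err_scale2 :: "nat \<Rightarrow> real \<Rightarrow> real" where
  "err_scale2 n a = sqrt N / (a * sqrt (1 - \<rho>\<^sup>2) * (- sqrt r2) ^ (n - 2))"

lemma decoder_past_out:
  assumes "2 \<le> n" "a \<noteq> 0"
  shows "decoder n a M1 M2 (past_out (enc1 n a M1) (enc2 n a M2) w1 w2 s z n)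
     = (round_msg M1 (real w1 / real M1 + err_scale1 n a * err1 n (n - 2) z),
        round_msg M2 (real w2 / real M2 + err_scale2 n a * err2 n (n - 2) z))"
proof -
  define Y where "Y = channel_out n a (real w1 / real M1) (real w2 / real M2) s z"
  have past: "past_out (enc1 n a M1) (enc2 n a M2) w1 w2 s z n = (\<lambda>j. if j < n then Y j else 0)"
    unfolding Y_def by (rule past_out_code) simp
  have cong: "lin_stat i g (n - 2) (\<lambda>j. if j < n then Y j else 0) = lin_stat i g (n - 2) Y"
    if "i < 2" for i g
    using that assms by (intro lin_stat_cong) auto
  have Y: "Y = (\<lambda>j. clean_out n a (real w1 / real M1) (real w2 / real M2) z j + s j + cancel n s j)"
    by (simp add: Y_def channel_out_def fun_eq_iff)
  have "lin_stat 0 gain1 (n - 2) Y / a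
      = (a * (real w1 / real M1) + sqrt N * err1 n (n - 2) z / sqrt r1 ^ (n - 2)) / a"
    using assms by (simp only: Y lin_stat_state_free lin_stat1_clean_out)
  also have "\<dots> = real w1 / real M1 + err_scale1 n a * err1 n (n - 2) z"
    using assms r1_ge_1 by (simp add: err_scale1_def field_simps)
  finally have stat1: "lin_stat 0 gain1 (n - 2) Y / a = \<dots>" .
  have "lin_stat 1 gain2 (n - 2) Y / a
      = (a * (real w2 / real M2) + sqrt N / sqrt (1 - \<rho>\<^sup>2) * err2 n (n - 2) z / (- sqrt r2) ^ (n - 2)) / a"
    using assms by (simp only: Y lin_stat_state_free lin_stat2_clean_out)
  also have "\<dots> = real w2 / real M2 + err_scale2 n a * err2 n (n - 2) z"
    using assms r2_ge_1 one_minus_rho_sq_pos by (simp add: err_scale2_def field_simps)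
  finally have stat2: "lin_stat 1 gain2 (n - 2) Y / a = \<dots>" .
  show ?thesis
    using cong[of 0 gain1] cong[of 1 gain2] by (simp only: decoder_def past stat1 stat2)
qed

lemma decoder_correct:
  assumes "2 \<le> n" "a \<noteq> 0" "0 < M1" "0 < M2"
    and "\<bar>err_scale1 n a * err1 n (n - 2) z\<bar> < 1 / (2 * real M1)"
    and "\<bar>err_scale2 n a * err2 n (n - 2) z\<bar> < 1 / (2 * real M2)"
  shows "decoder n a M1 M2 (past_out (enc1 n a M1) (enc2 n a M2) w1 w2 s z n) = (w1, w2)"
  using assms by (simp add: decoder_past_out round_msg_eq)

lemma err_scale1_sq: "(err_scale1 n a)\<^sup>2 = N / (a\<^sup>2 * r1 ^ (n - 2))"
  using N_pos r1_ge_1 by (simp add: err_scale1_def power_divide power_mult_distrib flip: real_sqrt_power)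

lemma err_scale2_sq: "(err_scale2 n a)\<^sup>2 = N / (1 - \<rho>\<^sup>2) / (a\<^sup>2 * r2 ^ (n - 2))"
proof -
  have "((- sqrt r2) ^ (n - 2))\<^sup>2 = (sqrt r2 ^ (n - 2))\<^sup>2"
    by (metis power2_minus power_mult mult.commute)
  also have "\<dots> = r2 ^ (n - 2)"
    using r2_ge_1 by (simp flip: real_sqrt_power)
  finally show ?thesis
    using N_pos one_minus_rho_sq_pos
    by (simp add: err_scale2_def power_divide power_mult_distrib field_simps)
qed

lemma code_measurable: "measurable_code (enc1 n a M1) (enc2 n a M2) (decoder n a M1 M2)"
proof -
  have enc1: "(\<lambda>(s, p). enc1 n a M1 k w s p) \<in> borel_measurable (PiM UNIV (\<lambda>_. borel) \<Otimes>\<^sub>M PiM UNIV (\<lambda>_. borel))" for k w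
    unfolding enc1_def Let_def lin_stat_def cancel_def case_prod_beta by measurable
  have enc2: "(\<lambda>(s, p). enc2 n a M2 k w s p) \<in> borel_measurable (PiM UNIV (\<lambda>_. borel) \<Otimes>\<^sub>M PiM UNIV (\<lambda>_. borel))" for k w
    unfolding enc2_def Let_def lin_stat_def cancel_def case_prod_beta by measurable
  have "decoder n a M1 M2 \<in> measurable (PiM UNIV (\<lambda>_. borel)) (count_space UNIV \<Otimes>\<^sub>M count_space UNIV)"
    unfolding decoder_def[abs_def] round_msg_def lin_stat_def by measurable
  then have "decoder n a M1 M2 \<in> measurable (PiM UNIV (\<lambda>_. borel)) (count_space UNIV)"
    by (simp add: pair_measure_countable)
  with enc1 enc2 show ?thesis
    by (simp add: measurable_code_def)
qed

end

section \<open>Power and error analysis\<close>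

locale ozarow_code = ozarow "\<sigma>\<^sup>2" x y \<rho> for \<sigma> x y \<rho> :: real +
  fixes DS :: "real measure"
  assumes sigma_pos: "0 < \<sigma>" and DS_prob: "prob_space DS" and DS_sets: "sets DS = sets borel"
    and DS_square: "integrable DS (\<lambda>v. v\<^sup>2)"
begin

abbreviation noise_space :: "nat \<Rightarrow> (nat \<Rightarrow> real) measure" where
  "noise_space n \<equiv> PiM {..<n} (\<lambda>_. density lborel (normal_density 0 \<sigma>))"

abbreviation state_space :: "nat \<Rightarrow> (nat \<Rightarrow> real) measure" where
  "state_space n \<equiv> PiM {..<n} (\<lambda>_. DS)"

definition state_power :: real where
  "state_power = (\<integral>v. v\<^sup>2 \<partial>DS)"

lemma prob_space_noise_space: "prob_space (noise_space n)"
  using sigma_pos by (intro prob_space_PiM prob_space_normal_zero)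

lemma prob_space_state_space: "prob_space (state_space n)"
  using DS_prob by (intro prob_space_PiM)

lemma prob_space_sample_space: "prob_space (sample_space DS \<sigma> n)"
  unfolding sample_space_def
  by (intro prob_space_pair prob_space_state_space prob_space_noise_space)

lemma distr_sample_space_snd: "distr (sample_space DS \<sigma> n) (noise_space n) snd = noise_space n"
  unfolding sample_space_def using prob_space_state_space prob_space_noise_space
  by (intro distr_pair_snd prob_space_imp_sigma_finite)

lemma distr_sample_space_fst: "distr (sample_space DS \<sigma> n) (state_space n) fst = state_space n"
  unfolding sample_space_def using prob_space_noise_space by (rule prob_space.distr_pair_fst)

lemma measurable_sample_noise_form[measurable]:
  "(\<lambda>\<omega>. c * (\<Sum>j<n. v j * snd \<omega> j)) \<in> borel_measurable (sample_space DS \<sigma> n)"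
  unfolding sample_space_def by measurable

lemma nn_integral_noise_form:
  assumes "cov n v v = 1"
  shows "(\<integral>\<^sup>+\<omega>. ennreal ((c * (\<Sum>j<n. v j * snd \<omega> j))\<^sup>2) \<partial>sample_space DS \<sigma> n) = ennreal (c\<^sup>2)"
proof -
  have "(\<integral>\<^sup>+\<omega>. ennreal ((c * (\<Sum>j<n. v j * snd \<omega> j))\<^sup>2) \<partial>sample_space DS \<sigma> n)
      = (\<integral>\<^sup>+z. ennreal ((\<Sum>j<n. (c * v j) * z j)\<^sup>2) \<partial>noise_space n)"
    by (subst distr_sample_space_snd[symmetric], subst nn_integral_distr)
      (simp_all add: sample_space_def sum_distrib_left mult.assoc)
  also have "\<dots> = ennreal (\<sigma>\<^sup>2 * (\<Sum>j<n. (c * v j)\<^sup>2))"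
    using sigma_pos integrable_square_lincomb_normal[of \<sigma> "{..<n}" "\<lambda>j. c * v j"]
      integral_square_lincomb_normal[of \<sigma> "{..<n}" "\<lambda>j. c * v j"]
    by (simp add: nn_integral_eq_integral)
  also have "\<sigma>\<^sup>2 * (\<Sum>j<n. (c * v j)\<^sup>2) = c\<^sup>2 * cov n v v"
    unfolding cov_def by (simp add: power_mult_distrib sum_distrib_left power2_eq_square algebra_simps)
  finally show ?thesis
    using assms by simp
qed

lemma measure_noise_form_ge:
  assumes "cov n v v = 1" "0 < \<delta>"
  shows "measure (sample_space DS \<sigma> n)
           {\<omega> \<in> space (sample_space DS \<sigma> n). \<delta> \<le> \<bar>c * (\<Sum>j<n. v j * snd \<omega> j)\<bar>} \<le> c\<^sup>2 / \<delta>\<^sup>2"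
proof -
  interpret prob_space "sample_space DS \<sigma> n"
    by (rule prob_space_sample_space)
  have int: "integrable (noise_space n) (\<lambda>z. (\<Sum>j<n. (c * v j) * z j)\<^sup>2)"
    using sigma_pos by (intro integrable_square_lincomb_normal) auto
  have "integrable (sample_space DS \<sigma> n) (\<lambda>\<omega>. (c * (\<Sum>j<n. v j * snd \<omega> j))\<^sup>2)"
    using int
    by (subst (asm) distr_sample_space_snd[symmetric], subst (asm) integrable_distr_eq)
      (simp_all add: sample_space_def sum_distrib_left mult.assoc)
  moreover have "(\<integral>\<omega>. (c * (\<Sum>j<n. v j * snd \<omega> j))\<^sup>2 \<partial>sample_space DS \<sigma> n) = c\<^sup>2"
  proof -
    have "(\<integral>\<omega>. (c * (\<Sum>j<n. v j * snd \<omega> j))\<^sup>2 \<partial>sample_space DS \<sigma> n)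
        = (\<integral>z. (\<Sum>j<n. (c * v j) * z j)\<^sup>2 \<partial>noise_space n)"
      by (subst distr_sample_space_snd[symmetric], subst integral_distr)
        (simp_all add: sample_space_def sum_distrib_left mult.assoc)
    also have "\<dots> = c\<^sup>2 * cov n v v"
      unfolding cov_def using sigma_pos
      by (simp only: integral_square_lincomb_normal finite_lessThan)
        (simp add: power_mult_distrib sum_distrib_left power2_eq_square algebra_simps)
    finally show ?thesis
      using assms by simp
  qed
  ultimately show ?thesis
    using second_moment_method[of "\<lambda>\<omega>. c * (\<Sum>j<n. v j * snd \<omega> j)" \<delta>] assms(2) by simp
qed

lemma measurable_state_component:
  assumes "j < n"
  shows "(\<lambda>s. s j) \<in> borel_measurable (state_space n)"
proof -
  have "(\<lambda>s. s j) \<in> measurable (state_space n) DS"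
    using assms by (intro measurable_component_singleton) simp
  then show ?thesis
    by (simp add: measurable_cong_sets[OF refl DS_sets])
qed

lemma measurable_lin_stat_state:
  assumes "i < n" "K + 2 \<le> n"
  shows "(\<lambda>s. lin_stat i g K s) \<in> borel_measurable (state_space n)"
  unfolding lin_stat_def using assms
  by (intro borel_measurable_diff borel_measurable_sum borel_measurable_times borel_measurable_const
      measurable_state_component) auto

lemma nn_integral_lin_stat_state_le:
  assumes "i < 2" "K + 2 \<le> n"
  shows "(\<integral>\<^sup>+\<omega>. ennreal ((lin_stat i g K (fst \<omega>))\<^sup>2) \<partial>sample_space DS \<sigma> n)
           \<le> ennreal ((1 + (\<Sum>m<K. \<bar>g m\<bar>))\<^sup>2 * state_power)"
proof -
  have meas: "(\<lambda>s. lin_stat i g K s) \<in> borel_measurable (state_space n)"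
    using assms by (intro measurable_lin_stat_state) auto
  have "(\<integral>\<^sup>+\<omega>. ennreal ((lin_stat i g K (fst \<omega>))\<^sup>2) \<partial>sample_space DS \<sigma> n)
      = (\<integral>\<^sup>+s. ennreal ((lin_stat i g K s)\<^sup>2) \<partial>state_space n)"
    by (subst distr_sample_space_fst[symmetric], subst nn_integral_distr)
      (use meas in \<open>simp_all add: sample_space_def\<close>)
  also have "\<dots> \<le> ennreal ((\<Sum>m<Suc K. \<bar>if m = 0 then 1 else - g (m - 1)\<bar>)\<^sup>2 * state_power)"
    unfolding lin_stat_eq_sum state_power_def
    using DS_prob DS_sets DS_square assms by (intro nn_integral_square_lincomb_le) auto
  also have "(\<Sum>m<Suc K. \<bar>if m = 0 then 1 else - g (m - 1)\<bar>) = 1 + (\<Sum>m<K. \<bar>g m\<bar>)"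
    unfolding sum.lessThan_Suc_shift by simp
  finally show ?thesis .
qed

lemma nn_integral_message_plus_state_le:
  assumes "i < 2" "K + 2 \<le> n" "0 \<le> \<theta>" "\<theta> \<le> 1" "(\<Sum>m<K. \<bar>g m\<bar>) \<le> G"
  shows "(\<integral>\<^sup>+\<omega>. ennreal ((a * \<theta> - lin_stat i g K (fst \<omega>))\<^sup>2) \<partial>sample_space DS \<sigma> n)
           \<le> ennreal (2 * a\<^sup>2 + 2 * (1 + G)\<^sup>2 * state_power)"
proof -
  interpret prob_space "sample_space DS \<sigma> n"
    by (rule prob_space_sample_space)
  have "(\<lambda>s. lin_stat i g K s) \<in> borel_measurable (state_space n)"
    using assms by (intro measurable_lin_stat_state) auto
  then have meas: "(\<lambda>\<omega>. lin_stat i g K (fst \<omega>)) \<in> borel_measurable (sample_space DS \<sigma> n)"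
    unfolding sample_space_def by (rule measurable_compose[OF measurable_fst])
  have P: "0 \<le> state_power"
    by (simp add: state_power_def)
  have "(\<integral>\<^sup>+\<omega>. ennreal ((a * \<theta> - lin_stat i g K (fst \<omega>))\<^sup>2) \<partial>sample_space DS \<sigma> n)
      \<le> (\<integral>\<^sup>+\<omega>. ennreal (2 * a\<^sup>2) + 2 * ennreal ((lin_stat i g K (fst \<omega>))\<^sup>2) \<partial>sample_space DS \<sigma> n)"
  proof (intro nn_integral_mono)
    fix \<omega>
    define L where "L = lin_stat i g K (fst \<omega>)"
    have "(a * \<theta>)\<^sup>2 \<le> a\<^sup>2"
      using assms(3,4) mult_left_mono[of "\<theta>\<^sup>2" 1 "a\<^sup>2"] by (simp add: power_mult_distrib power_le_one)
    moreover have "(a * \<theta> - L)\<^sup>2 \<le> 2 * (a * \<theta>)\<^sup>2 + 2 * L\<^sup>2"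
      using sum_squares_ge_zero[of "a * \<theta> + L" 0] by (simp add: power2_eq_square algebra_simps)
    ultimately have "ennreal ((a * \<theta> - L)\<^sup>2) \<le> ennreal (2 * a\<^sup>2 + 2 * L\<^sup>2)"
      by (intro ennreal_leI) simp
    then show "ennreal ((a * \<theta> - L)\<^sup>2) \<le> ennreal (2 * a\<^sup>2) + 2 * ennreal (L\<^sup>2)"
      by (simp add: ennreal_plus ennreal_mult)
  qed
  also have "\<dots> = ennreal (2 * a\<^sup>2) + 2 * (\<integral>\<^sup>+\<omega>. ennreal ((lin_stat i g K (fst \<omega>))\<^sup>2) \<partial>sample_space DS \<sigma> n)"
    using meas by (simp add: nn_integral_add nn_integral_cmult emeasure_space_1)
  also have "\<dots> \<le> ennreal (2 * a\<^sup>2) + 2 * ennreal ((1 + G)\<^sup>2 * state_power)"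
  proof -
    have "(1 + (\<Sum>m<K. \<bar>g m\<bar>))\<^sup>2 * state_power \<le> (1 + G)\<^sup>2 * state_power"
      using assms(5) P by (intro mult_right_mono power_mono) (auto simp: sum_nonneg)
    then show ?thesis
      using nn_integral_lin_stat_state_le[OF assms(1,2), of g]
      by (intro add_mono order_refl mult_left_mono) (auto intro: order_trans ennreal_leI)
  qed
  also have "\<dots> = ennreal (2 * a\<^sup>2 + 2 * (1 + G)\<^sup>2 * state_power)"
    using P by (simp add: ennreal_plus ennreal_mult mult.assoc)
  finally show ?thesis .
qed

lemma nn_integral_err1:
  "m + 2 \<le> n \<Longrightarrow> (\<integral>\<^sup>+\<omega>. ennreal ((c * err1 n m (snd \<omega>))\<^sup>2) \<partial>sample_space DS \<sigma> n) = ennreal (c\<^sup>2)"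
  using standardized_err_coeffs[of m n] by (simp add: err1_def standardized_def nn_integral_noise_form)

lemma nn_integral_err2:
  "m + 2 \<le> n \<Longrightarrow> (\<integral>\<^sup>+\<omega>. ennreal ((c * err2 n m (snd \<omega>))\<^sup>2) \<partial>sample_space DS \<sigma> n) = ennreal (c\<^sup>2)"
  using standardized_err_coeffs[of m n] by (simp add: err2_def standardized_def nn_integral_noise_form)

text \<open>Energy per block beyond the message point and the steady-state transmissions: the state
  cancellation and, for encoder 1, the correction sent at time 1.\<close>
definition overhead1 :: real where
  "overhead1 = 2 * (1 + gain_bound1)\<^sup>2 * state_power + (mu * \<sigma>)\<^sup>2"

definition overhead2 :: real where
  "overhead2 = 2 * (1 + gain_bound2)\<^sup>2 * state_power"

lemma energy1_le:
  assumes n: "2 \<le> n" and \<theta>: "0 \<le> \<theta>" "\<theta> \<le> 1"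
  shows "(\<Sum>k<n. \<integral>\<^sup>+\<omega>. ennreal ((input1 n a \<theta> (fst \<omega>) (snd \<omega>) k)\<^sup>2) \<partial>sample_space DS \<sigma> n)
           \<le> ennreal (2 * a\<^sup>2 + overhead1 + real (n - 2) * x\<^sup>2)"
proof -
  let ?E = "\<lambda>k. \<integral>\<^sup>+\<omega>. ennreal ((input1 n a \<theta> (fst \<omega>) (snd \<omega>) k)\<^sup>2) \<partial>sample_space DS \<sigma> n"
  have "?E 0 \<le> ennreal (2 * a\<^sup>2 + 2 * (1 + gain_bound1)\<^sup>2 * state_power)"
    using nn_integral_message_plus_state_le[of 0 "n - 2" n \<theta> gain1 gain_bound1 a] n \<theta> sum_abs_gain1_le
    by (simp add: input1_def cancel_def)
  moreover have "?E 1 = ennreal ((mu * \<sigma>)\<^sup>2)"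
  proof -
    have "input1 n a \<theta> s z 1 = mu * \<sigma> * err1 n 0 z" for s z
      using err1_0[of n z] n sigma_pos by (simp add: input1_def)
    then show ?thesis
      using nn_integral_err1[of 0 n "mu * \<sigma>"] n by simp
  qed
  moreover have "?E (m + 2) = ennreal (x\<^sup>2)" if "m < n - 2" for m
    using nn_integral_err1[of m n x] that by (simp add: input1_def)
  ultimately have "(\<Sum>k<n. ?E k) \<le> ennreal (2 * a\<^sup>2 + 2 * (1 + gain_bound1)\<^sup>2 * state_power)
      + ennreal ((mu * \<sigma>)\<^sup>2) + (\<Sum>m<n - 2. ennreal (x\<^sup>2))"
    unfolding sum_lessThan_split2[OF n] by (intro add_mono order_refl) simp_all
  also have "\<dots> = ennreal (2 * a\<^sup>2 + overhead1 + real (n - 2) * x\<^sup>2)"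
    by (simp add: overhead1_def state_power_def ennreal_plus ennreal_mult ennreal_of_nat_eq_real_of_nat
        add.assoc)
  finally show ?thesis .
qed

lemma energy2_le:
  assumes n: "2 \<le> n" and \<theta>: "0 \<le> \<theta>" "\<theta> \<le> 1"
  shows "(\<Sum>k<n. \<integral>\<^sup>+\<omega>. ennreal ((input2 n a \<theta> (fst \<omega>) (snd \<omega>) k)\<^sup>2) \<partial>sample_space DS \<sigma> n)
           \<le> ennreal (2 * a\<^sup>2 + overhead2 + real (n - 2) * y\<^sup>2)"
proof -
  let ?E = "\<lambda>k. \<integral>\<^sup>+\<omega>. ennreal ((input2 n a \<theta> (fst \<omega>) (snd \<omega>) k)\<^sup>2) \<partial>sample_space DS \<sigma> n"
  have "?E 0 = 0"
    by (simp add: input2_def)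
  moreover have "?E 1 \<le> ennreal (2 * a\<^sup>2 + overhead2)"
    using nn_integral_message_plus_state_le[of 1 "n - 2" n \<theta> gain2 gain_bound2 a] n \<theta> sum_abs_gain2_le
    by (simp add: input2_def cancel_def overhead2_def)
  moreover have "?E (m + 2) = ennreal (y\<^sup>2)" if "m < n - 2" for m
    using nn_integral_err2[of m n y] that by (simp add: input2_def)
  ultimately have "(\<Sum>k<n. ?E k) \<le> ennreal (2 * a\<^sup>2 + overhead2) + (\<Sum>m<n - 2. ennreal (y\<^sup>2))"
    unfolding sum_lessThan_split2[OF n] by (intro add_mono order_refl) simp_all
  also have "\<dots> = ennreal (2 * a\<^sup>2 + overhead2 + real (n - 2) * y\<^sup>2)"
    by (simp add: overhead2_def state_power_def ennreal_plus ennreal_mult ennreal_of_nat_eq_real_of_nat)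
  finally show ?thesis .
qed

lemma total_energy1_le:
  assumes "2 \<le> n"
  shows "total_energy DS \<sigma> n M1 M2 (enc1 n a M1) (enc2 n a M2) (enc1 n a M1) True
           \<le> ennreal (real M1 * real M2 * (2 * a\<^sup>2 + overhead1 + real (n - 2) * x\<^sup>2))"
proof (rule total_energy_le)
  fix w1 w2 assume w: "w1 \<in> {1..M1}" "w2 \<in> {1..M2}"
  have "(\<Sum>k<n. \<integral>\<^sup>+\<omega>. ennreal ((mac_input (enc1 n a M1) (enc1 n a M1) (enc2 n a M2) (if True then w1 else w2)
            w1 w2 (fst \<omega>) (snd \<omega>) k)\<^sup>2) \<partial>sample_space DS \<sigma> n)
      = (\<Sum>k<n. \<integral>\<^sup>+\<omega>. ennreal ((input1 n a (real w1 / real M1) (fst \<omega>) (snd \<omega>) k)\<^sup>2) \<partial>sample_space DS \<sigma> n)"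
    by (intro sum.cong refl) (simp add: mac_input_enc1)
  also have "\<dots> \<le> ennreal (2 * a\<^sup>2 + overhead1 + real (n - 2) * x\<^sup>2)"
    using assms w by (intro energy1_le) auto
  finally show "(\<Sum>k<n. \<integral>\<^sup>+\<omega>. ennreal ((mac_input (enc1 n a M1) (enc1 n a M1) (enc2 n a M2) (if True then w1 else w2)
            w1 w2 (fst \<omega>) (snd \<omega>) k)\<^sup>2) \<partial>sample_space DS \<sigma> n) \<le> \<dots>" .
next
  show "0 \<le> 2 * a\<^sup>2 + overhead1 + real (n - 2) * x\<^sup>2"
    by (simp add: overhead1_def state_power_def)
qed

lemma total_energy2_le:
  assumes "2 \<le> n"
  shows "total_energy DS \<sigma> n M1 M2 (enc1 n a M1) (enc2 n a M2) (enc2 n a M2) False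
           \<le> ennreal (real M1 * real M2 * (2 * a\<^sup>2 + overhead2 + real (n - 2) * y\<^sup>2))"
proof (rule total_energy_le)
  fix w1 w2 assume w: "w1 \<in> {1..M1}" "w2 \<in> {1..M2}"
  have "(\<Sum>k<n. \<integral>\<^sup>+\<omega>. ennreal ((mac_input (enc2 n a M2) (enc1 n a M1) (enc2 n a M2) (if False then w1 else w2)
            w1 w2 (fst \<omega>) (snd \<omega>) k)\<^sup>2) \<partial>sample_space DS \<sigma> n)
      = (\<Sum>k<n. \<integral>\<^sup>+\<omega>. ennreal ((input2 n a (real w2 / real M2) (fst \<omega>) (snd \<omega>) k)\<^sup>2) \<partial>sample_space DS \<sigma> n)"
    by (intro sum.cong refl) (simp add: mac_input_enc2)
  also have "\<dots> \<le> ennreal (2 * a\<^sup>2 + overhead2 + real (n - 2) * y\<^sup>2)"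
    using assms w by (intro energy2_le) auto
  finally show "(\<Sum>k<n. \<integral>\<^sup>+\<omega>. ennreal ((mac_input (enc2 n a M2) (enc1 n a M1) (enc2 n a M2) (if False then w1 else w2)
            w1 w2 (fst \<omega>) (snd \<omega>) k)\<^sup>2) \<partial>sample_space DS \<sigma> n) \<le> \<dots>" .
next
  show "0 \<le> 2 * a\<^sup>2 + overhead2 + real (n - 2) * y\<^sup>2"
    by (simp add: overhead2_def state_power_def)
qed

lemma eventually_power_constraints:
  assumes "0 < \<epsilon>"
  shows "eventually (\<lambda>n.
     total_energy DS \<sigma> n (M1 n) (M2 n) (enc1 n (amp n) (M1 n)) (enc2 n (amp n) (M2 n)) (enc1 n (amp n) (M1 n)) True
       \<le> ennreal (real n * real (M1 n) * real (M2 n) * (x\<^sup>2 + \<epsilon>)) \<and>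
     total_energy DS \<sigma> n (M1 n) (M2 n) (enc1 n (amp n) (M1 n)) (enc2 n (amp n) (M2 n)) (enc2 n (amp n) (M2 n)) False
       \<le> ennreal (real n * real (M1 n) * real (M2 n) * (y\<^sup>2 + \<epsilon>))) sequentially"
  using eventually_sqrt_le[OF assms, of overhead1] eventually_sqrt_le[OF assms, of overhead2]
    eventually_ge_at_top[of 2]
proof eventually_elim
  case (elim n)
  have "real (M1 n) * real (M2 n) * (2 * (amp n)\<^sup>2 + overhead1 + real (n - 2) * x\<^sup>2)
      \<le> real (M1 n) * real (M2 n) * (real n * (x\<^sup>2 + \<epsilon>))"
    using elim energy_budget_le[of n overhead1 \<epsilon> "x\<^sup>2"] by (intro mult_left_mono) auto
  moreover have "real (M1 n) * real (M2 n) * (2 * (amp n)\<^sup>2 + overhead2 + real (n - 2) * y\<^sup>2)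
      \<le> real (M1 n) * real (M2 n) * (real n * (y\<^sup>2 + \<epsilon>))"
    using elim energy_budget_le[of n overhead2 \<epsilon> "y\<^sup>2"] by (intro mult_left_mono) auto
  ultimately show ?case
    using elim total_energy1_le[of n "M1 n" "M2 n" "amp n"] total_energy2_le[of n "M1 n" "M2 n" "amp n"]
    by (auto simp: ac_simps intro: order_trans ennreal_leI)
qed

lemma error_event_le:
  assumes n: "2 \<le> n" and a: "0 < a" and M: "0 < M1" "0 < M2"
  shows "measure (sample_space DS \<sigma> n) {\<omega> \<in> space (sample_space DS \<sigma> n).
           decoder n a M1 M2 (past_out (enc1 n a M1) (enc2 n a M2) w1 w2 (fst \<omega>) (snd \<omega>) n) \<noteq> (w1, w2)}
         \<le> 4 * (real M1)\<^sup>2 * (err_scale1 n a)\<^sup>2 + 4 * (real M2)\<^sup>2 * (err_scale2 n a)\<^sup>2"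
proof -
  interpret prob_space "sample_space DS \<sigma> n"
    by (rule prob_space_sample_space)
  define A1 where "A1 = {\<omega> \<in> space (sample_space DS \<sigma> n).
    1 / (2 * real M1) \<le> \<bar>err_scale1 n a * (\<Sum>j<n. fst (err_coeffs (n - 2)) j * snd \<omega> j)\<bar>}"
  define A2 where "A2 = {\<omega> \<in> space (sample_space DS \<sigma> n).
    1 / (2 * real M2) \<le> \<bar>err_scale2 n a * (\<Sum>j<n. snd (err_coeffs (n - 2)) j * snd \<omega> j)\<bar>}"
  have "A1 \<in> sets (sample_space DS \<sigma> n)" "A2 \<in> sets (sample_space DS \<sigma> n)"
    unfolding A1_def A2_def by measurable
  moreover have "{\<omega> \<in> space (sample_space DS \<sigma> n).
      decoder n a M1 M2 (past_out (enc1 n a M1) (enc2 n a M2) w1 w2 (fst \<omega>) (snd \<omega>) n) \<noteq> (w1, w2)}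
      \<subseteq> A1 \<union> A2"
  proof
    fix \<omega>
    assume \<omega>: "\<omega> \<in> {\<omega> \<in> space (sample_space DS \<sigma> n).
      decoder n a M1 M2 (past_out (enc1 n a M1) (enc2 n a M2) w1 w2 (fst \<omega>) (snd \<omega>) n) \<noteq> (w1, w2)}"
    show "\<omega> \<in> A1 \<union> A2"
    proof (rule ccontr)
      assume "\<omega> \<notin> A1 \<union> A2"
      then have "\<bar>err_scale1 n a * err1 n (n - 2) (snd \<omega>)\<bar> < 1 / (2 * real M1)"
        "\<bar>err_scale2 n a * err2 n (n - 2) (snd \<omega>)\<bar> < 1 / (2 * real M2)"
        using \<omega> by (auto simp: A1_def A2_def err1_def err2_def)
      with \<omega> show False
        using decoder_correct[OF n] a M by simp
    qed
  qed
  ultimately have "measure (sample_space DS \<sigma> n) {\<omega> \<in> space (sample_space DS \<sigma> n).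
      decoder n a M1 M2 (past_out (enc1 n a M1) (enc2 n a M2) w1 w2 (fst \<omega>) (snd \<omega>) n) \<noteq> (w1, w2)}
      \<le> measure (sample_space DS \<sigma> n) A1 + measure (sample_space DS \<sigma> n) A2"
    by (intro order_trans[OF finite_measure_mono measure_Un_le]) auto
  also have "\<dots> \<le> (err_scale1 n a)\<^sup>2 / (1 / (2 * real M1))\<^sup>2 + (err_scale2 n a)\<^sup>2 / (1 / (2 * real M2))\<^sup>2"
    using standardized_err_coeffs[of "n - 2" n] n M unfolding A1_def A2_def
    by (intro add_mono measure_noise_form_ge) (auto simp: standardized_def)
  finally show ?thesis
    by (simp add: power_divide field_simps)
qed

lemma error_prob_amp_le:
  fixes n :: nat
  defines "M1 \<equiv> num_msgs (1/2 * log 2 r1) n" and "M2 \<equiv> num_msgs (1/2 * log 2 r2) n"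
  assumes n: "2 \<le> n"
  shows "error_prob DS \<sigma> n M1 M2 (enc1 n (amp n) M1) (enc2 n (amp n) M2) (decoder n (amp n) M1 M2)
           \<le> (16 * \<sigma>\<^sup>2 * r1\<^sup>2 + 16 * (\<sigma>\<^sup>2 / (1 - \<rho>\<^sup>2)) * r2\<^sup>2) / sqrt (real n)"
proof -
  have amp: "0 < amp n" "(amp n)\<^sup>2 = sqrt (real n)"
    using n by (simp_all add: amp_def)
  have "error_prob DS \<sigma> n M1 M2 (enc1 n (amp n) M1) (enc2 n (amp n) M2) (decoder n (amp n) M1 M2)
      \<le> 4 * (real M1)\<^sup>2 * (err_scale1 n (amp n))\<^sup>2 + 4 * (real M2)\<^sup>2 * (err_scale2 n (amp n))\<^sup>2"
    using n amp by (intro error_prob_le error_event_le) (simp_all add: M1_def M2_def num_msgs_pos)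
  also have "\<dots> = 4 * (real M1)\<^sup>2 * (\<sigma>\<^sup>2 / ((amp n)\<^sup>2 * r1 ^ (n - 2)))
        + 4 * (real M2)\<^sup>2 * (\<sigma>\<^sup>2 / (1 - \<rho>\<^sup>2) / ((amp n)\<^sup>2 * r2 ^ (n - 2)))"
    by (simp only: err_scale1_sq err_scale2_sq)
  also have "\<dots> \<le> 16 * \<sigma>\<^sup>2 * r1\<^sup>2 / (amp n)\<^sup>2 + 16 * (\<sigma>\<^sup>2 / (1 - \<rho>\<^sup>2)) * r2\<^sup>2 / (amp n)\<^sup>2"
    unfolding M1_def M2_def using n amp one_minus_rho_sq_pos
    by (intro add_mono msgs_error_term_le num_msgs_square_le r1_ge_1 r2_ge_1) auto
  finally show ?thesis
    using amp by (simp add: add_divide_distrib)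
qed

lemma error_prob_tendsto_0:
  defines "M1 \<equiv> \<lambda>n. num_msgs (1/2 * log 2 r1) n" and "M2 \<equiv> \<lambda>n. num_msgs (1/2 * log 2 r2) n"
  shows "(\<lambda>n. error_prob DS \<sigma> n (M1 n) (M2 n) (enc1 n (amp n) (M1 n)) (enc2 n (amp n) (M2 n))
            (decoder n (amp n) (M1 n) (M2 n))) \<longlonglongrightarrow> 0"
proof (rule tendsto_sandwich[OF _ _ tendsto_const tendsto_const_over_sqrt])
  show "eventually (\<lambda>n. error_prob DS \<sigma> n (M1 n) (M2 n) (enc1 n (amp n) (M1 n)) (enc2 n (amp n) (M2 n))
      (decoder n (amp n) (M1 n) (M2 n))
      \<le> (16 * \<sigma>\<^sup>2 * r1\<^sup>2 + 16 * (\<sigma>\<^sup>2 / (1 - \<rho>\<^sup>2)) * r2\<^sup>2) / sqrt (real n)) sequentially"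
    using eventually_ge_at_top[of "2 :: nat"] unfolding M1_def M2_def
    by eventually_elim (rule error_prob_amp_le)
qed (simp add: error_prob_def sum_nonneg)

theorem achievable_rates: "achievable DS \<sigma> (x\<^sup>2) (y\<^sup>2) (1/2 * log 2 r1) (1/2 * log 2 r2)"
proof -
  define M1 where "M1 n = num_msgs (1/2 * log 2 r1) n" for n
  define M2 where "M2 n = num_msgs (1/2 * log 2 r2) n" for n
  show ?thesis
    unfolding achievable_def M1_def[symmetric] M2_def[symmetric]
    using code_measurable eventually_power_constraints error_prob_tendsto_0[folded M1_def M2_def]
    by (intro exI[of _ "\<lambda>n. enc1 n (amp n) (M1 n)"] exI[of _ "\<lambda>n. enc2 n (amp n) (M2 n)"]
        exI[of _ "\<lambda>n. decoder n (amp n) (M1 n) (M2 n)"]) blast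
qed

end

lemma sum_rate_fixed_point:
  fixes N P1 P2 \<rho> :: real
  assumes "0 < N" "0 \<le> P1" "0 \<le> P2" "0 \<le> \<rho>" "\<rho> \<le> 1"
    and "1/2 * log 2 (1 + P1 * (1 - \<rho>\<^sup>2) / N) + 1/2 * log 2 (1 + P2 * (1 - \<rho>\<^sup>2) / N)
           = 1/2 * log 2 (1 + (P1 + P2 + 2 * \<rho> * sqrt (P1 * P2)) / N)"
  shows "(N + P1 * (1 - \<rho>\<^sup>2)) * (N + P2 * (1 - \<rho>\<^sup>2)) = N * (P1 + P2 + 2 * \<rho> * sqrt (P1 * P2) + N)"
proof -
  define A B C where "A = 1 + P1 * (1 - \<rho>\<^sup>2) / N" and "B = 1 + P2 * (1 - \<rho>\<^sup>2) / N"
    and "C = 1 + (P1 + P2 + 2 * \<rho> * sqrt (P1 * P2)) / N"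
  have pos: "0 < A" "0 < B" "0 < C"
    using assms(1-5) by (auto simp: A_def B_def C_def power_le_one intro!: add_pos_nonneg)
  have "log 2 (A * B) = log 2 C"
    using assms(6) pos by (simp add: A_def B_def C_def log_mult)
  then have "2 powr log 2 (A * B) = 2 powr log 2 C"
    by simp
  then have "A * B = C"
    using pos by simp
  have "(N + P1 * (1 - \<rho>\<^sup>2)) * (N + P2 * (1 - \<rho>\<^sup>2)) = N * N * (A * B)"
    using assms(1) by (simp add: A_def B_def field_simps)
  also have "\<dots> = N * (P1 + P2 + 2 * \<rho> * sqrt (P1 * P2) + N)"
    using assms(1) by (simp add: \<open>A * B = C\<close> C_def field_simps)
  finally show ?thesis .
qed

theorem mainTheorem5:
  fixes DS :: "real measure" and sigmaZ P1 P2 \<rho> R1 R2 :: real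
  assumes DS_prob: "prob_space DS"
      and DS_sets: "sets DS = sets borel"
      and DS_var: "integrable DS (\<lambda>x. x\<^sup>2)"
      and DS_mean: "integrable DS (\<lambda>x. x)" "(\<integral>x. x \<partial>DS) = 0"
      and sigmaZ_pos: "sigmaZ > 0"
      and P1: "P1 \<ge> 0" and P2: "P2 \<ge> 0"
      and rho: "0 \<le> \<rho>" "\<rho> \<le> 1"
      and R1: "R1 = 1/2 * log 2 (1 + P1 * (1 - \<rho>\<^sup>2) / sigmaZ\<^sup>2)"
      and R2: "R2 = 1/2 * log 2 (1 + P2 * (1 - \<rho>\<^sup>2) / sigmaZ\<^sup>2)"
      and Rsum: "R1 + R2 = 1/2 * log 2 (1 + (P1 + P2 + 2 * \<rho> * sqrt (P1 * P2)) / sigmaZ\<^sup>2)"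
  shows "achievable DS sigmaZ P1 P2 R1 R2"
proof (cases "\<rho> < 1 \<and> 0 < P1 + P2")
  case False
  then have "\<rho> = 1 \<or> (P1 = 0 \<and> P2 = 0)"
    using rho P1 P2 by auto
  then show ?thesis
    using R1 R2 achievable_zero_rates by auto
next
  case True
  define x y where "x = sqrt P1" and "y = sqrt P2"
  have "ozarow_code sigmaZ x y \<rho> DS"
    using True rho sigmaZ_pos DS_prob DS_sets DS_var P1 P2
      sum_rate_fixed_point[of "sigmaZ\<^sup>2" P1 P2 \<rho>] Rsum[unfolded R1 R2]
    by (simp add: ozarow_code_def ozarow_def ozarow_code_axioms_def x_def y_def real_sqrt_mult)
  then interpret ozarow_code sigmaZ x y \<rho> DS .
  show ?thesis
    using achievable_rates P1 P2 unfolding r1_def r2_def by (simp add: R1 R2 x_def y_def)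
qed

end
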